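(* The generalised uniformity principle GUP-CZF is incompatible in CZF with the restricted De Morgan law $$(\forall p\in \mathsf{Pow}(\{\top\}))\ p^{**}\cup p^{*}=\{\top\},$$ that is, CZF together with GUP-CZF and this law is inconsistent. Likewise, in CTT the generalised uniformity principle GUP-CTT is incompatible with De Morgan law DML.
   Context: CZF is Aczel's constructive Zermelo-Fraenkel set theory; CTT is Martin-Löf's constructive type theory (propositions-as-sets). $\mathsf{Pow}(\{\top\})$ is the class of subsets of a one-element set $\{\top\}$; for $p\in\mathsf{Pow}(\{\top\})$, $p^{*}\equiv\{x\in\{\top\}: x\notin p\}$ and $p^{**}\equiv(p^* )^*$. GUP-CZF is the scheme: for every set $I$ and every formula $A$, $(\forall x)(\exists y\in I)A(x,y)\to(\exists y\in I)(\forall x)A(x,y)$, where $x$ ranges over all sets. GUP-CTT: given any set $I$, any mapping $R$ taking a proposition $P$ and an element $i$ of $I$ to a proposition $R(P,i)$, and any mapping $F$ from the type $PROP$ of propositions to $I$ such that $R(P,F(P))$ holds for all $P$, there is an element $\bar i\in I$ such that $R(P,\bar i)$ holds for all $P$. DML is the law: $\neg\neg P\vee\neg P$ for all propositions $P$ (equivalent to $\neg(P\wedge Q)\to\neg P\vee\neg Q$ for all $P,Q$). *)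

theory Defs
  imports Main
begin

section \<open>Constructive Zermelo-Fraenkel set theory\<close>

subsection \<open>Intuitionistic first-order logic with equality\<close>

text \<open>Formulas of the language of set theory, with de Bruijn indices: the variable 0 refers to the
  innermost quantifier, and variables not captured by any quantifier are free.\<close>

datatype fm =
    Eq nat nat
  | Mem nat nat
  | Bot
  | And fm fm
  | Or fm fm
  | Imp fm fm
  | All fm
  | Ex fm

abbreviation Neg :: "fm \<Rightarrow> fm" where "Neg A \<equiv> Imp A Bot"
abbreviation Iff :: "fm \<Rightarrow> fm \<Rightarrow> fm" where "Iff A B \<equiv> And (Imp A B) (Imp B A)"

text \<open>Bounded quantifiers; the bound \<open>a\<close> is a variable of the context outside of the quantifier.\<close>

abbreviation Ball_fm :: "nat \<Rightarrow> fm \<Rightarrow> fm" where "Ball_fm a A \<equiv> All (Imp (Mem 0 (Suc a)) A)"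
abbreviation Bex_fm :: "nat \<Rightarrow> fm \<Rightarrow> fm" where "Bex_fm a A \<equiv> Ex (And (Mem 0 (Suc a)) A)"

definition up_ren :: "(nat \<Rightarrow> nat) \<Rightarrow> nat \<Rightarrow> nat" where
  "up_ren r = case_nat 0 (Suc \<circ> r)"

primrec ren_fm :: "(nat \<Rightarrow> nat) \<Rightarrow> fm \<Rightarrow> fm" where
  "ren_fm r (Eq i j) = Eq (r i) (r j)"
| "ren_fm r (Mem i j) = Mem (r i) (r j)"
| "ren_fm r Bot = Bot"
| "ren_fm r (And A B) = And (ren_fm r A) (ren_fm r B)"
| "ren_fm r (Or A B) = Or (ren_fm r A) (ren_fm r B)"
| "ren_fm r (Imp A B) = Imp (ren_fm r A) (ren_fm r B)"
| "ren_fm r (All A) = All (ren_fm (up_ren r) A)"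
| "ren_fm r (Ex A) = Ex (ren_fm (up_ren r) A)"

abbreviation lift_fm :: "fm \<Rightarrow> fm" where "lift_fm \<equiv> ren_fm Suc"

text \<open>\<open>plug d xs A\<close> is the formula \<open>A(x\<^sub>0, \<dots>, x\<^sub>n\<^sub>-\<^sub>1)\<close> placed below \<open>d\<close> quantifiers: the first
  \<open>n = length xs\<close> variables of \<open>A\<close> are replaced by the variables \<open>xs\<close>, and the remaining ones are
  parameters, which refer to the context outside of the \<open>d\<close> quantifiers.\<close>

definition plug :: "nat \<Rightarrow> nat list \<Rightarrow> fm \<Rightarrow> fm" where
  "plug d xs = ren_fm (\<lambda>i. if i < length xs then xs ! i else i - length xs + d)"

text \<open>Natural deduction for intuitionistic predicate logic. \<open>T\<close> is the set of nonlogical axioms and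
  \<open>\<Gamma>\<close> the set of open assumptions. Free variables of axioms are read as universally quantified
  (the axioms are not lifted when passing below a quantifier), whereas free variables of
  assumptions are fixed.\<close>

inductive derivable :: "fm set \<Rightarrow> fm set \<Rightarrow> fm \<Rightarrow> bool" for T :: "fm set" where
  ax: "A \<in> T \<Longrightarrow> derivable T \<Gamma> A"
| hyp: "A \<in> \<Gamma> \<Longrightarrow> derivable T \<Gamma> A"
| BotE: "derivable T \<Gamma> Bot \<Longrightarrow> derivable T \<Gamma> A"
| AndI: "derivable T \<Gamma> A \<Longrightarrow> derivable T \<Gamma> B \<Longrightarrow> derivable T \<Gamma> (And A B)"
| AndE1: "derivable T \<Gamma> (And A B) \<Longrightarrow> derivable T \<Gamma> A"
| AndE2: "derivable T \<Gamma> (And A B) \<Longrightarrow> derivable T \<Gamma> B"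
| OrI1: "derivable T \<Gamma> A \<Longrightarrow> derivable T \<Gamma> (Or A B)"
| OrI2: "derivable T \<Gamma> B \<Longrightarrow> derivable T \<Gamma> (Or A B)"
| OrE: "derivable T \<Gamma> (Or A B) \<Longrightarrow> derivable T (insert A \<Gamma>) C \<Longrightarrow> derivable T (insert B \<Gamma>) C
    \<Longrightarrow> derivable T \<Gamma> C"
| ImpI: "derivable T (insert A \<Gamma>) B \<Longrightarrow> derivable T \<Gamma> (Imp A B)"
| ImpE: "derivable T \<Gamma> (Imp A B) \<Longrightarrow> derivable T \<Gamma> A \<Longrightarrow> derivable T \<Gamma> B"
| AllI: "derivable T (lift_fm ` \<Gamma>) A \<Longrightarrow> derivable T \<Gamma> (All A)"
| AllE: "derivable T \<Gamma> (All A) \<Longrightarrow> derivable T \<Gamma> (plug 0 [k] A)"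
| ExI: "derivable T \<Gamma> (plug 0 [k] A) \<Longrightarrow> derivable T \<Gamma> (Ex A)"
| ExE: "derivable T \<Gamma> (Ex A) \<Longrightarrow> derivable T (insert A (lift_fm ` \<Gamma>)) (lift_fm C)
    \<Longrightarrow> derivable T \<Gamma> C"
| EqI: "derivable T \<Gamma> (Eq k k)"
| EqE: "derivable T \<Gamma> (Eq j k) \<Longrightarrow> derivable T \<Gamma> (plug 0 [j] A) \<Longrightarrow> derivable T \<Gamma> (plug 0 [k] A)"

subsection \<open>The axioms of CZF\<close>

inductive bounded_fm :: "fm \<Rightarrow> bool" where
  "bounded_fm (Eq i j)"
| "bounded_fm (Mem i j)"
| "bounded_fm Bot"
| "bounded_fm A \<Longrightarrow> bounded_fm B \<Longrightarrow> bounded_fm (And A B)"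
| "bounded_fm A \<Longrightarrow> bounded_fm B \<Longrightarrow> bounded_fm (Or A B)"
| "bounded_fm A \<Longrightarrow> bounded_fm B \<Longrightarrow> bounded_fm (Imp A B)"
| "bounded_fm A \<Longrightarrow> bounded_fm (Ball_fm a A)"
| "bounded_fm A \<Longrightarrow> bounded_fm (Bex_fm a A)"

definition Empty_fm :: "nat \<Rightarrow> fm" where
  "Empty_fm x = All (Neg (Mem 0 (Suc x)))"

text \<open>\<open>y = x \<union> {x}\<close>\<close>
definition Succ_fm :: "nat \<Rightarrow> nat \<Rightarrow> fm" where
  "Succ_fm y x = All (Iff (Mem 0 (Suc y)) (Or (Mem 0 (Suc x)) (Eq 0 (Suc x))))"

definition Ind_fm :: "nat \<Rightarrow> fm" where
  "Ind_fm a = And (Bex_fm a (Empty_fm 0)) (Ball_fm a (Bex_fm (Suc a) (Succ_fm 0 1)))"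

inductive_set CZF :: "fm set" where
  Extensionality:
    "All (All (Imp (All (Iff (Mem 0 2) (Mem 0 1))) (Eq 1 0))) \<in> CZF"
| Pairing:
    "All (All (Ex (All (Iff (Mem 0 1) (Or (Eq 0 3) (Eq 0 2)))))) \<in> CZF"
| Union:
    "All (Ex (All (Iff (Mem 0 1) (Bex_fm 2 (Mem 1 0))))) \<in> CZF"
| Strong_Infinity:
    "Ex (And (Ind_fm 0) (All (Imp (Ind_fm 0) (Ball_fm 1 (Mem 0 1))))) \<in> CZF"
| Set_Induction: \<comment> \<open>\<open>A(x)\<close>\<close>
    "Imp (All (Imp (Ball_fm 0 (plug 2 [0] A)) (plug 1 [0] A))) (All (plug 1 [0] A)) \<in> CZF"
| Bounded_Separation: \<comment> \<open>\<open>A(x, a)\<close>\<close>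
    "bounded_fm A \<Longrightarrow> All (Ex (All (Iff (Mem 0 1) (And (Mem 0 2) (plug 3 [0, 2] A))))) \<in> CZF"
| Strong_Collection: \<comment> \<open>\<open>A(x, y, a)\<close>\<close>
    "All (Imp (Ball_fm 0 (Ex (plug 3 [1, 0, 2] A)))
       (Ex (And (Ball_fm 1 (Bex_fm 1 (plug 4 [1, 0, 3] A)))
                (Ball_fm 0 (Bex_fm 2 (plug 4 [0, 1, 3] A)))))) \<in> CZF"
| Subset_Collection: \<comment> \<open>\<open>A(x, y, u, a, b)\<close>\<close>
    "All (All (Ex (All (Imp (Ball_fm 3 (Bex_fm 3 (plug 6 [1, 0, 2, 5, 4] A)))
       (Bex_fm 1 (And (Ball_fm 4 (Bex_fm 1 (plug 7 [1, 0, 3, 6, 5] A)))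
                      (Ball_fm 0 (Bex_fm 5 (plug 7 [0, 1, 3, 6, 5] A))))))))) \<in> CZF"

subsection \<open>The generalised uniformity principle and the restricted De Morgan law\<close>

text \<open>The instance for \<open>A(x, y, I)\<close>, possibly with further parameters.\<close>

definition GUP_CZF :: "fm set" where
  "GUP_CZF = {All (Imp (All (Bex_fm 1 (plug 3 [1, 0, 2] A)))
                       (Bex_fm 0 (All (plug 3 [0, 1, 2] A)))) | A. True}"

text \<open>Class notation. A class \<open>{x. A(x)}\<close> is represented by the formula \<open>A\<close> whose variable 0 is \<open>x\<close>;
  a variable \<open>k\<close> of the ambient context is therefore \<open>Suc k\<close> in \<open>A\<close>.\<close>

definition set_cl :: "nat \<Rightarrow> fm" where "set_cl p = Mem 0 (Suc p)"
definition sing_cl :: "nat \<Rightarrow> fm" where "sing_cl t = Eq 0 (Suc t)"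
definition un_cl :: "fm \<Rightarrow> fm \<Rightarrow> fm" where "un_cl A B = Or A B"
definition eq_cl :: "fm \<Rightarrow> fm \<Rightarrow> fm" where "eq_cl A B = All (Iff A B)"
definition subset_cl :: "fm \<Rightarrow> fm \<Rightarrow> fm" where "subset_cl A B = All (Imp A B)"

text \<open>\<open>p\<^sup>* = {x \<in> {t}. x \<notin> p}\<close>\<close>
definition star_cl :: "nat \<Rightarrow> fm \<Rightarrow> fm" where "star_cl t A = And (sing_cl t) (Neg A)"

text \<open>The restricted De Morgan law for the one-element set whose element \<open>\<top>\<close> is the value of the
  variable \<open>t\<close>.\<close>

definition DML_CZF :: "nat \<Rightarrow> fm" where
  "DML_CZF t =
    All (Imp (subset_cl (set_cl 0) (sing_cl (Suc t)))
      (eq_cl (un_cl (star_cl (Suc t) (star_cl (Suc t) (set_cl 0))) (star_cl (Suc t) (set_cl 0)))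
             (sing_cl (Suc t))))"


section \<open>Constructive type theory\<close>

text \<open>Intensional Martin-Loef type theory, presented in Martin-Loef's logical framework. The types
  are \<open>SET\<close> (the type of sets, or propositions), \<open>El A\<close> for \<open>A : SET\<close>, and the dependent function
  types \<open>(x:\<alpha>)\<beta>\<close>; the sets are introduced by typed constants and computation rules.\<close>

subsection \<open>Syntax\<close>

text \<open>Constants. The natural number arguments are universe levels; \<open>cu\<dots> n\<close> is the code in the
  universe \<open>U\<^sub>n\<close> of the corresponding set former. The finite sets with more than two elements are
  definable by \<open>cPlus\<close>.\<close>

datatype const =
    cPi | cLam | cApp
  | cSigma | cPair | cSplit
  | cPlus | cInl | cInr | cWhen
  | cId | cRefl | cJ
  | cN0 | cCase0
  | cN1 | cElem1 | cCase1
  | cN2 | cLeft2 | cRight2 | cCase2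
  | cNat | cZero | cSucc | cNatrec
  | cW | cSup | cWrec
  | cU nat | cT nat
  | cuPi nat | cuSigma nat | cuPlus nat | cuId nat | cuN0 nat | cuN1 nat | cuN2 nat | cuNat nat
  | cuW nat | cuU nat | cuLift nat

datatype tm =
    V nat
  | C const
  | Abs tm
  | App tm tm (infixl "\<cdot>" 100)

datatype ty =
    SET
  | El tm
  | Fun ty ty (infixr "\<rightarrowtail>" 60) \<comment> \<open>the dependent type \<open>(x:\<alpha>)\<beta>\<close>, binding variable 0 of \<open>\<beta>\<close>\<close>

declare [[coercion_enabled]] [[coercion C]]

primrec ren_tm :: "(nat \<Rightarrow> nat) \<Rightarrow> tm \<Rightarrow> tm" where
  "ren_tm r (V i) = V (r i)"
| "ren_tm r (C c) = C c"
| "ren_tm r (Abs b) = Abs (ren_tm (up_ren r) b)"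
| "ren_tm r (f \<cdot> a) = ren_tm r f \<cdot> ren_tm r a"

primrec ren_ty :: "(nat \<Rightarrow> nat) \<Rightarrow> ty \<Rightarrow> ty" where
  "ren_ty r SET = SET"
| "ren_ty r (El A) = El (ren_tm r A)"
| "ren_ty r (\<alpha> \<rightarrowtail> \<beta>) = (ren_ty r \<alpha> \<rightarrowtail> ren_ty (up_ren r) \<beta>)"

abbreviation lift_tm :: "tm \<Rightarrow> tm" where "lift_tm \<equiv> ren_tm Suc"

definition up_sub :: "(nat \<Rightarrow> tm) \<Rightarrow> nat \<Rightarrow> tm" where
  "up_sub s = case_nat (V 0) (lift_tm \<circ> s)"

primrec sub_tm :: "(nat \<Rightarrow> tm) \<Rightarrow> tm \<Rightarrow> tm" where
  "sub_tm s (V i) = s i"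
| "sub_tm s (C c) = C c"
| "sub_tm s (Abs b) = Abs (sub_tm (up_sub s) b)"
| "sub_tm s (f \<cdot> a) = sub_tm s f \<cdot> sub_tm s a"

primrec sub_ty :: "(nat \<Rightarrow> tm) \<Rightarrow> ty \<Rightarrow> ty" where
  "sub_ty s SET = SET"
| "sub_ty s (El A) = El (sub_tm s A)"
| "sub_ty s (\<alpha> \<rightarrowtail> \<beta>) = (sub_ty s \<alpha> \<rightarrowtail> sub_ty (up_sub s) \<beta>)"

text \<open>Instantiation of variable 0.\<close>

abbreviation inst_tm :: "tm \<Rightarrow> tm \<Rightarrow> tm" where "inst_tm b a \<equiv> sub_tm (case_nat a V) b"
abbreviation inst_ty :: "ty \<Rightarrow> tm \<Rightarrow> ty" where "inst_ty \<beta> a \<equiv> sub_ty (case_nat a V) \<beta>"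

subsection \<open>Types of the constants\<close>

primrec const_ty :: "const \<Rightarrow> ty" where
  \<comment> \<open>\<open>(A:SET)(B:(A)SET) SET\<close>\<close>
  "const_ty cPi = (SET \<rightarrowtail> (El (V 0) \<rightarrowtail> SET) \<rightarrowtail> SET)"
  \<comment> \<open>\<open>(A)(B)(b:(x:A)B(x)) \<Pi>(A,B)\<close>\<close>
| "const_ty cLam = (SET \<rightarrowtail> (El (V 0) \<rightarrowtail> SET) \<rightarrowtail> (El (V 1) \<rightarrowtail> El (V 1 \<cdot> V 0)) \<rightarrowtail> El (cPi \<cdot> V 2 \<cdot> V 1))"
  \<comment> \<open>\<open>(A)(B)(f:\<Pi>(A,B))(a:A) B(a)\<close>\<close>
| "const_ty cApp = (SET \<rightarrowtail> (El (V 0) \<rightarrowtail> SET) \<rightarrowtail> El (cPi \<cdot> V 1 \<cdot> V 0) \<rightarrowtail> El (V 2) \<rightarrowtail> El (V 2 \<cdot> V 0))"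

| "const_ty cSigma = (SET \<rightarrowtail> (El (V 0) \<rightarrowtail> SET) \<rightarrowtail> SET)"
  \<comment> \<open>\<open>(A)(B)(a:A)(b:B(a)) \<Sigma>(A,B)\<close>\<close>
| "const_ty cPair = (SET \<rightarrowtail> (El (V 0) \<rightarrowtail> SET) \<rightarrowtail> El (V 1) \<rightarrowtail> El (V 1 \<cdot> V 0) \<rightarrowtail> El (cSigma \<cdot> V 3 \<cdot> V 2))"
  \<comment> \<open>\<open>(A)(B)(C:(\<Sigma>(A,B))SET)(d:(x:A)(y:B(x))C(pair(A,B,x,y)))(c:\<Sigma>(A,B)) C(c)\<close>\<close>
| "const_ty cSplit = (SET \<rightarrowtail> (El (V 0) \<rightarrowtail> SET) \<rightarrowtail> (El (cSigma \<cdot> V 1 \<cdot> V 0) \<rightarrowtail> SET)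
     \<rightarrowtail> (El (V 2) \<rightarrowtail> El (V 2 \<cdot> V 0) \<rightarrowtail> El (V 2 \<cdot> (cPair \<cdot> V 4 \<cdot> V 3 \<cdot> V 1 \<cdot> V 0)))
     \<rightarrowtail> El (cSigma \<cdot> V 3 \<cdot> V 2) \<rightarrowtail> El (V 2 \<cdot> V 0))"

| "const_ty cPlus = (SET \<rightarrowtail> SET \<rightarrowtail> SET)"
| "const_ty cInl = (SET \<rightarrowtail> SET \<rightarrowtail> El (V 1) \<rightarrowtail> El (cPlus \<cdot> V 2 \<cdot> V 1))"
| "const_ty cInr = (SET \<rightarrowtail> SET \<rightarrowtail> El (V 0) \<rightarrowtail> El (cPlus \<cdot> V 2 \<cdot> V 1))"
  \<comment> \<open>\<open>(A)(B)(C:(A+B)SET)(d:(x:A)C(inl(A,B,x)))(e:(y:B)C(inr(A,B,y)))(c:A+B) C(c)\<close>\<close>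
| "const_ty cWhen = (SET \<rightarrowtail> SET \<rightarrowtail> (El (cPlus \<cdot> V 1 \<cdot> V 0) \<rightarrowtail> SET)
     \<rightarrowtail> (El (V 2) \<rightarrowtail> El (V 1 \<cdot> (cInl \<cdot> V 3 \<cdot> V 2 \<cdot> V 0)))
     \<rightarrowtail> (El (V 2) \<rightarrowtail> El (V 2 \<cdot> (cInr \<cdot> V 4 \<cdot> V 3 \<cdot> V 0)))
     \<rightarrowtail> El (cPlus \<cdot> V 4 \<cdot> V 3) \<rightarrowtail> El (V 3 \<cdot> V 0))"

  \<comment> \<open>\<open>(A)(a:A)(b:A) SET\<close>\<close>
| "const_ty cId = (SET \<rightarrowtail> El (V 0) \<rightarrowtail> El (V 1) \<rightarrowtail> SET)"
| "const_ty cRefl = (SET \<rightarrowtail> El (V 0) \<rightarrowtail> El (cId \<cdot> V 1 \<cdot> V 0 \<cdot> V 0))"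
  \<comment> \<open>\<open>(A)(C:(x:A)(y:A)(Id(A,x,y))SET)(d:(x:A)C(x,x,refl(A,x)))(a:A)(b:A)(c:Id(A,a,b)) C(a,b,c)\<close>\<close>
| "const_ty cJ = (SET \<rightarrowtail> (El (V 0) \<rightarrowtail> El (V 1) \<rightarrowtail> El (cId \<cdot> V 2 \<cdot> V 1 \<cdot> V 0) \<rightarrowtail> SET)
     \<rightarrowtail> (El (V 1) \<rightarrowtail> El (V 1 \<cdot> V 0 \<cdot> V 0 \<cdot> (cRefl \<cdot> V 2 \<cdot> V 0)))
     \<rightarrowtail> El (V 2) \<rightarrowtail> El (V 3) \<rightarrowtail> El (cId \<cdot> V 4 \<cdot> V 1 \<cdot> V 0)
     \<rightarrowtail> El (V 4 \<cdot> V 2 \<cdot> V 1 \<cdot> V 0))"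

| "const_ty cN0 = SET"
| "const_ty cCase0 = ((El cN0 \<rightarrowtail> SET) \<rightarrowtail> El cN0 \<rightarrowtail> El (V 1 \<cdot> V 0))"

| "const_ty cN1 = SET"
| "const_ty cElem1 = El cN1"
| "const_ty cCase1 = ((El cN1 \<rightarrowtail> SET) \<rightarrowtail> El (V 0 \<cdot> cElem1) \<rightarrowtail> El cN1 \<rightarrowtail> El (V 2 \<cdot> V 0))"

| "const_ty cN2 = SET"
| "const_ty cLeft2 = El cN2"
| "const_ty cRight2 = El cN2"
| "const_ty cCase2 = ((El cN2 \<rightarrowtail> SET) \<rightarrowtail> El (V 0 \<cdot> cLeft2) \<rightarrowtail> El (V 1 \<cdot> cRight2)
     \<rightarrowtail> El cN2 \<rightarrowtail> El (V 3 \<cdot> V 0))"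

| "const_ty cNat = SET"
| "const_ty cZero = El cNat"
| "const_ty cSucc = (El cNat \<rightarrowtail> El cNat)"
  \<comment> \<open>\<open>(C:(N)SET)(d:C(0))(e:(x:N)(y:C(x))C(succ(x)))(n:N) C(n)\<close>\<close>
| "const_ty cNatrec = ((El cNat \<rightarrowtail> SET) \<rightarrowtail> El (V 0 \<cdot> cZero)
     \<rightarrowtail> (El cNat \<rightarrowtail> El (V 2 \<cdot> V 0) \<rightarrowtail> El (V 3 \<cdot> (cSucc \<cdot> V 1)))
     \<rightarrowtail> El cNat \<rightarrowtail> El (V 3 \<cdot> V 0))"

| "const_ty cW = (SET \<rightarrowtail> (El (V 0) \<rightarrowtail> SET) \<rightarrowtail> SET)"
  \<comment> \<open>\<open>(A)(B)(a:A)(f:(B(a))W(A,B)) W(A,B)\<close>\<close>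
| "const_ty cSup = (SET \<rightarrowtail> (El (V 0) \<rightarrowtail> SET) \<rightarrowtail> El (V 1) \<rightarrowtail> (El (V 1 \<cdot> V 0) \<rightarrowtail> El (cW \<cdot> V 3 \<cdot> V 2))
     \<rightarrowtail> El (cW \<cdot> V 3 \<cdot> V 2))"
  \<comment> \<open>\<open>(A)(B)(C:(W(A,B))SET)(d:(x:A)(y:(B(x))W(A,B))(z:(v:B(x))C(y(v)))C(sup(A,B,x,y)))(w:W(A,B)) C(w)\<close>\<close>
| "const_ty cWrec = (SET \<rightarrowtail> (El (V 0) \<rightarrowtail> SET) \<rightarrowtail> (El (cW \<cdot> V 1 \<cdot> V 0) \<rightarrowtail> SET)
     \<rightarrowtail> (El (V 2) \<rightarrowtail> (El (V 2 \<cdot> V 0) \<rightarrowtail> El (cW \<cdot> V 4 \<cdot> V 3))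
        \<rightarrowtail> (El (V 3 \<cdot> V 1) \<rightarrowtail> El (V 3 \<cdot> (V 1 \<cdot> V 0)))
        \<rightarrowtail> El (V 3 \<cdot> (cSup \<cdot> V 5 \<cdot> V 4 \<cdot> V 2 \<cdot> V 1)))
     \<rightarrowtail> El (cW \<cdot> V 3 \<cdot> V 2) \<rightarrowtail> El (V 2 \<cdot> V 0))"

| "const_ty (cU n) = SET"
| "const_ty (cT n) = (El (cU n) \<rightarrowtail> SET)"
| "const_ty (cuPi n) = (El (cU n) \<rightarrowtail> (El (cT n \<cdot> V 0) \<rightarrowtail> El (cU n)) \<rightarrowtail> El (cU n))"
| "const_ty (cuSigma n) = (El (cU n) \<rightarrowtail> (El (cT n \<cdot> V 0) \<rightarrowtail> El (cU n)) \<rightarrowtail> El (cU n))"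
| "const_ty (cuPlus n) = (El (cU n) \<rightarrowtail> El (cU n) \<rightarrowtail> El (cU n))"
| "const_ty (cuId n) = (El (cU n) \<rightarrowtail> El (cT n \<cdot> V 0) \<rightarrowtail> El (cT n \<cdot> V 1) \<rightarrowtail> El (cU n))"
| "const_ty (cuN0 n) = El (cU n)"
| "const_ty (cuN1 n) = El (cU n)"
| "const_ty (cuN2 n) = El (cU n)"
| "const_ty (cuNat n) = El (cU n)"
| "const_ty (cuW n) = (El (cU n) \<rightarrowtail> (El (cT n \<cdot> V 0) \<rightarrowtail> El (cU n)) \<rightarrowtail> El (cU n))"
| "const_ty (cuU n) = El (cU (Suc n))"
| "const_ty (cuLift n) = (El (cU n) \<rightarrowtail> El (cU (Suc n)))"

subsection \<open>Computation rules\<close>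

inductive comp :: "tm \<Rightarrow> tm \<Rightarrow> bool" where
  "comp (cApp \<cdot> A \<cdot> B \<cdot> (cLam \<cdot> A \<cdot> B \<cdot> b) \<cdot> a) (b \<cdot> a)"
| "comp (cSplit \<cdot> A \<cdot> B \<cdot> K \<cdot> d \<cdot> (cPair \<cdot> A \<cdot> B \<cdot> a \<cdot> b)) (d \<cdot> a \<cdot> b)"
| "comp (cWhen \<cdot> A \<cdot> B \<cdot> K \<cdot> d \<cdot> e \<cdot> (cInl \<cdot> A \<cdot> B \<cdot> a)) (d \<cdot> a)"
| "comp (cWhen \<cdot> A \<cdot> B \<cdot> K \<cdot> d \<cdot> e \<cdot> (cInr \<cdot> A \<cdot> B \<cdot> b)) (e \<cdot> b)"
| "comp (cJ \<cdot> A \<cdot> K \<cdot> d \<cdot> a \<cdot> a \<cdot> (cRefl \<cdot> A \<cdot> a)) (d \<cdot> a)"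
| "comp (cCase1 \<cdot> K \<cdot> c \<cdot> cElem1) c"
| "comp (cCase2 \<cdot> K \<cdot> c \<cdot> d \<cdot> cLeft2) c"
| "comp (cCase2 \<cdot> K \<cdot> c \<cdot> d \<cdot> cRight2) d"
| "comp (cNatrec \<cdot> K \<cdot> d \<cdot> e \<cdot> cZero) d"
| "comp (cNatrec \<cdot> K \<cdot> d \<cdot> e \<cdot> (cSucc \<cdot> n)) (e \<cdot> n \<cdot> (cNatrec \<cdot> K \<cdot> d \<cdot> e \<cdot> n))"
| "comp (cWrec \<cdot> A \<cdot> B \<cdot> K \<cdot> d \<cdot> (cSup \<cdot> A \<cdot> B \<cdot> a \<cdot> f))
     (d \<cdot> a \<cdot> f \<cdot> Abs (lift_tm (cWrec \<cdot> A \<cdot> B \<cdot> K \<cdot> d) \<cdot> (lift_tm f \<cdot> V 0)))"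
| "comp (cT n \<cdot> (cuPi n \<cdot> a \<cdot> b)) (cPi \<cdot> (cT n \<cdot> a) \<cdot> Abs (cT n \<cdot> (lift_tm b \<cdot> V 0)))"
| "comp (cT n \<cdot> (cuSigma n \<cdot> a \<cdot> b)) (cSigma \<cdot> (cT n \<cdot> a) \<cdot> Abs (cT n \<cdot> (lift_tm b \<cdot> V 0)))"
| "comp (cT n \<cdot> (cuPlus n \<cdot> a \<cdot> b)) (cPlus \<cdot> (cT n \<cdot> a) \<cdot> (cT n \<cdot> b))"
| "comp (cT n \<cdot> (cuId n \<cdot> a \<cdot> b \<cdot> c)) (cId \<cdot> (cT n \<cdot> a) \<cdot> b \<cdot> c)"
| "comp (cT n \<cdot> cuN0 n) cN0"
| "comp (cT n \<cdot> cuN1 n) cN1"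
| "comp (cT n \<cdot> cuN2 n) cN2"
| "comp (cT n \<cdot> cuNat n) cNat"
| "comp (cT n \<cdot> (cuW n \<cdot> a \<cdot> b)) (cW \<cdot> (cT n \<cdot> a) \<cdot> Abs (cT n \<cdot> (lift_tm b \<cdot> V 0)))"
| "comp (cT (Suc n) \<cdot> cuU n) (cU n)"
| "comp (cT (Suc n) \<cdot> (cuLift n \<cdot> a)) (cT n \<cdot> a)"

subsection \<open>Judgements\<close>

text \<open>Contexts are lists with the most recent assumption first; the type of variable \<open>i\<close> is
  \<open>\<Gamma> ! i\<close>, which lives in the context \<open>drop (Suc i) \<Gamma>\<close>. Weakening and substitution are admissible.
  A computation rule is available whenever both of its sides have the same type; the usual premises of
  the rule then follow from the well-typedness of its left-hand side.\<close>

inductive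
  is_ctx :: "ty list \<Rightarrow> bool" and
  is_type :: "ty list \<Rightarrow> ty \<Rightarrow> bool" and
  eq_type :: "ty list \<Rightarrow> ty \<Rightarrow> ty \<Rightarrow> bool" and
  has_type :: "ty list \<Rightarrow> tm \<Rightarrow> ty \<Rightarrow> bool" and
  eq_term :: "ty list \<Rightarrow> tm \<Rightarrow> tm \<Rightarrow> ty \<Rightarrow> bool"
where
  ctx_Nil: "is_ctx []"
| ctx_Cons: "is_ctx \<Gamma> \<Longrightarrow> is_type \<Gamma> \<alpha> \<Longrightarrow> is_ctx (\<alpha> # \<Gamma>)"

| type_SET: "is_ctx \<Gamma> \<Longrightarrow> is_type \<Gamma> SET"
| type_El: "has_type \<Gamma> A SET \<Longrightarrow> is_type \<Gamma> (El A)"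
| type_Fun: "is_type \<Gamma> \<alpha> \<Longrightarrow> is_type (\<alpha> # \<Gamma>) \<beta> \<Longrightarrow> is_type \<Gamma> (\<alpha> \<rightarrowtail> \<beta>)"

| eq_type_refl: "is_type \<Gamma> \<alpha> \<Longrightarrow> eq_type \<Gamma> \<alpha> \<alpha>"
| eq_type_sym: "eq_type \<Gamma> \<alpha> \<beta> \<Longrightarrow> eq_type \<Gamma> \<beta> \<alpha>"
| eq_type_trans: "eq_type \<Gamma> \<alpha> \<beta> \<Longrightarrow> eq_type \<Gamma> \<beta> \<gamma> \<Longrightarrow> eq_type \<Gamma> \<alpha> \<gamma>"
| eq_type_El: "eq_term \<Gamma> A B SET \<Longrightarrow> eq_type \<Gamma> (El A) (El B)"
| eq_type_Fun: "eq_type \<Gamma> \<alpha> \<alpha>' \<Longrightarrow> eq_type (\<alpha> # \<Gamma>) \<beta> \<beta>' \<Longrightarrow> eq_type \<Gamma> (\<alpha> \<rightarrowtail> \<beta>) (\<alpha>' \<rightarrowtail> \<beta>')"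

| var: "is_ctx \<Gamma> \<Longrightarrow> i < length \<Gamma> \<Longrightarrow> has_type \<Gamma> (V i) (ren_ty ((+) (Suc i)) (\<Gamma> ! i))"
| const: "is_ctx \<Gamma> \<Longrightarrow> has_type \<Gamma> (C c) (const_ty c)"
| abs: "is_type \<Gamma> \<alpha> \<Longrightarrow> has_type (\<alpha> # \<Gamma>) b \<beta> \<Longrightarrow> has_type \<Gamma> (Abs b) (\<alpha> \<rightarrowtail> \<beta>)"
| app: "has_type \<Gamma> f (\<alpha> \<rightarrowtail> \<beta>) \<Longrightarrow> has_type \<Gamma> a \<alpha> \<Longrightarrow> has_type \<Gamma> (f \<cdot> a) (inst_ty \<beta> a)"
| conv: "has_type \<Gamma> a \<alpha> \<Longrightarrow> eq_type \<Gamma> \<alpha> \<beta> \<Longrightarrow> has_type \<Gamma> a \<beta>"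

| eq_refl: "has_type \<Gamma> a \<alpha> \<Longrightarrow> eq_term \<Gamma> a a \<alpha>"
| eq_sym: "eq_term \<Gamma> a b \<alpha> \<Longrightarrow> eq_term \<Gamma> b a \<alpha>"
| eq_trans: "eq_term \<Gamma> a b \<alpha> \<Longrightarrow> eq_term \<Gamma> b c \<alpha> \<Longrightarrow> eq_term \<Gamma> a c \<alpha>"
| eq_conv: "eq_term \<Gamma> a b \<alpha> \<Longrightarrow> eq_type \<Gamma> \<alpha> \<beta> \<Longrightarrow> eq_term \<Gamma> a b \<beta>"
| eq_abs: "is_type \<Gamma> \<alpha> \<Longrightarrow> eq_term (\<alpha> # \<Gamma>) b b' \<beta> \<Longrightarrow> eq_term \<Gamma> (Abs b) (Abs b') (\<alpha> \<rightarrowtail> \<beta>)"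
| eq_app: "eq_term \<Gamma> f f' (\<alpha> \<rightarrowtail> \<beta>) \<Longrightarrow> eq_term \<Gamma> a a' \<alpha> \<Longrightarrow> eq_term \<Gamma> (f \<cdot> a) (f' \<cdot> a') (inst_ty \<beta> a)"
| eq_beta: "has_type (\<alpha> # \<Gamma>) b \<beta> \<Longrightarrow> has_type \<Gamma> a \<alpha> \<Longrightarrow>
    eq_term \<Gamma> (Abs b \<cdot> a) (inst_tm b a) (inst_ty \<beta> a)"
| eq_eta: "has_type \<Gamma> f (\<alpha> \<rightarrowtail> \<beta>) \<Longrightarrow> eq_term \<Gamma> (Abs (lift_tm f \<cdot> V 0)) f (\<alpha> \<rightarrowtail> \<beta>)"
| eq_comp: "comp l r \<Longrightarrow> has_type \<Gamma> l \<alpha> \<Longrightarrow> has_type \<Gamma> r \<alpha> \<Longrightarrow> eq_term \<Gamma> l r \<alpha>"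

subsection \<open>The generalised uniformity principle and De Morgan's law\<close>

text \<open>Propositions as sets.\<close>

abbreviation PROP_ty :: ty where "PROP_ty \<equiv> SET"
abbreviation Falsum :: tm where "Falsum \<equiv> C cN0"
definition Not_tm :: "tm \<Rightarrow> tm" where "Not_tm A = cPi \<cdot> A \<cdot> Abs Falsum"
definition Or_tm :: "tm \<Rightarrow> tm \<Rightarrow> tm" where "Or_tm A B = cPlus \<cdot> A \<cdot> B"

text \<open>The types of the two parts of the principle:
    \<open>gup\<^sub>0 : (I:SET)(R:(P:PROP)(i:I)PROP)(F:(P:PROP)I)(h:(P:PROP)R(P,F(P))) I\<close>  and
    \<open>gup\<^sub>1 : (I:SET)(R:(P:PROP)(i:I)PROP)(F:(P:PROP)I)(h:(P:PROP)R(P,F(P)))(P:PROP) R(P, gup\<^sub>0(I,R,F,h))\<close>.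
  The second type depends on a variable \<open>gup\<^sub>0\<close> of the first type. Extending the theory by the
  principle amounts to working in the context \<open>GUP_CTT\<close>; note that these types quantify over \<open>SET\<close>,
  hence are types of the logical framework and not sets.\<close>

definition GUP_elem_ty :: ty where
  "GUP_elem_ty =
    (SET \<rightarrowtail> (PROP_ty \<rightarrowtail> El (V 1) \<rightarrowtail> PROP_ty) \<rightarrowtail> (PROP_ty \<rightarrowtail> El (V 2))
     \<rightarrowtail> (PROP_ty \<rightarrowtail> El (V 2 \<cdot> V 0 \<cdot> (V 1 \<cdot> V 0))) \<rightarrowtail> El (V 3))"

definition GUP_proof_ty :: ty where
  "GUP_proof_ty =
    (SET \<rightarrowtail> (PROP_ty \<rightarrowtail> El (V 1) \<rightarrowtail> PROP_ty) \<rightarrowtail> (PROP_ty \<rightarrowtail> El (V 2))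
     \<rightarrowtail> (PROP_ty \<rightarrowtail> El (V 2 \<cdot> V 0 \<cdot> (V 1 \<cdot> V 0)))
     \<rightarrowtail> PROP_ty \<rightarrowtail> El (V 3 \<cdot> V 0 \<cdot> (V 5 \<cdot> V 4 \<cdot> V 3 \<cdot> V 2 \<cdot> V 1)))"

definition GUP_CTT :: "ty list" where "GUP_CTT = [GUP_proof_ty, GUP_elem_ty]"

text \<open>\<open>(P:PROP) \<not>\<not>P \<or> \<not>P\<close>\<close>
definition DML_CTT :: ty where
  "DML_CTT = (PROP_ty \<rightarrowtail> El (Or_tm (Not_tm (Not_tm (V 0))) (Not_tm (V 0))))"

end

theory Submission
  imports Defs
begin

text \<open>De Morgan's law assigns to every proposition \<open>P\<close> a truth value \<open>F(P)\<close> in a set \<open>I\<close>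
  containing representatives of true and false, such that \<open>\<not>P\<close> holds iff \<open>F(P)\<close> represents a false proposition.
  The uniformity principle turns this into a single truth value that agrees with all propositions
  up to negation; it would have to be false since it agrees with \<open>\<bottom>\<close>, and not false since it agrees
  with \<open>\<top>\<close>. In set theory \<open>I = {\<emptyset>, {\<top>}}\<close>, the proposition coded by a set \<open>x\<close> being \<open>\<top> \<in> x\<close>; in
  type theory \<open>I\<close> is the universe \<open>U\<^sub>0\<close>, as a two-element set has no elimination into propositions.\<close>

section \<open>Renaming in type theory\<close>

text \<open>The left disjunct of the law is only \<open>\<not>\<not>P\<close>, so a truth value can
  match \<open>P\<close> no better than up to negation; hence the relation fed to the uniformity
  principle compares \<open>\<not>P\<close> with the negation of the chosen value. In set theory the
  obstacle is one of range: the principle quantifies over all sets, the restricted law over subsets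
  of \<open>{\<top>}\<close>. Bounded Separation bridges the gap: for any \<open>x\<close> the law
  is applied to \<open>{y \<in> x. y = \<top>}\<close>, which contains \<open>\<top>\<close> just
  when \<open>x\<close> does. In type theory the obstacle is uniformity in \<open>P\<close>: the
  truth value and the proof relating it to \<open>P\<close> must be terms in a variable
  \<open>P\<close>, so the case distinction on the proof of
  \<open>\<not>\<not>P \<or> \<not>P\<close> cannot be made outside the calculus and is done by the
  dependent eliminator \<open>cWhen\<close>. Computation there holds only up to conversion, so most
  of the work is typing. Of the structural rules only weakening is proved, as a special case of
  renaming; where an instance of substitution is wanted, an abstraction is applied and
  beta-reduced.\<close>

lemma up_ren_simps [simp]: "up_ren r 0 = 0" "up_ren r (Suc i) = Suc (r i)"
  by (simp_all add: up_ren_def)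

lemma up_sub_simps [simp]: "up_sub s 0 = V 0" "up_sub s (Suc i) = lift_tm (s i)"
  by (simp_all add: up_sub_def)

lemma up_ren_comp: "(\<lambda>i. up_ren r (up_ren s i)) = up_ren (\<lambda>i. r (s i))"
  by (rule ext, case_tac i) simp_all

text \<open>This and the following rules fuse nested renamings and substitutions into a single one.
  An equation between de Bruijn terms then reduces to an equation between functions on indices,
  settled by cases on the index.\<close>

lemma ren_ren_tm [simp]: "ren_tm r (ren_tm s t) = ren_tm (\<lambda>i. r (s i)) t"
  by (induction t arbitrary: r s) (simp_all add: up_ren_comp)

lemma ren_ren_ty [simp]: "ren_ty r (ren_ty s \<alpha>) = ren_ty (\<lambda>i. r (s i)) \<alpha>"
  by (induction \<alpha> arbitrary: r s) (simp_all add: up_ren_comp)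

lemma up_sub_up_ren: "(\<lambda>i. up_sub s (up_ren r i)) = up_sub (\<lambda>i. s (r i))"
  by (rule ext, case_tac i) simp_all

lemma sub_ren_tm [simp]: "sub_tm s (ren_tm r t) = sub_tm (\<lambda>i. s (r i)) t"
  by (induction t arbitrary: r s) (simp_all add: up_sub_up_ren)

lemma sub_ren_ty [simp]: "sub_ty s (ren_ty r \<alpha>) = sub_ty (\<lambda>i. s (r i)) \<alpha>"
  by (induction \<alpha> arbitrary: r s) (simp_all add: up_sub_up_ren)

lemma up_ren_up_sub: "(\<lambda>i. ren_tm (up_ren r) (up_sub s i)) = up_sub (\<lambda>i. ren_tm r (s i))"
  by (rule ext, case_tac i) simp_all

lemma ren_sub_tm [simp]: "ren_tm r (sub_tm s t) = sub_tm (\<lambda>i. ren_tm r (s i)) t"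
  by (induction t arbitrary: r s) (simp_all add: up_ren_up_sub)

lemma ren_sub_ty [simp]: "ren_ty r (sub_ty s \<alpha>) = sub_ty (\<lambda>i. ren_tm r (s i)) \<alpha>"
  by (induction \<alpha> arbitrary: r s) (simp_all add: up_ren_up_sub)

lemma up_sub_V: "up_sub (\<lambda>i. V (r i)) = (\<lambda>i. V (up_ren r i))"
  by (rule ext, case_tac i) simp_all

lemma sub_V_tm [simp]: "sub_tm (\<lambda>i. V (r i)) t = ren_tm r t"
  by (induction t arbitrary: r) (simp_all add: up_sub_V)

lemma sub_V_ty [simp]: "sub_ty (\<lambda>i. V (r i)) \<alpha> = ren_ty r \<alpha>"
  by (induction \<alpha> arbitrary: r) (simp_all add: up_sub_V)

lemma up_ren_id: "up_ren (\<lambda>i. i) = (\<lambda>i. i)"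
  by (rule ext, case_tac i) simp_all

lemma ren_id_tm [simp]: "ren_tm (\<lambda>i. i) t = t"
  by (induction t) (simp_all add: up_ren_id)

lemma ren_id_ty [simp]: "ren_ty (\<lambda>i. i) \<alpha> = \<alpha>"
  by (induction \<alpha>) (simp_all add: up_ren_id)

lemma sub_var_tm [simp]: "sub_tm V t = t"
  using sub_V_tm[of "\<lambda>i. i" t] by simp

lemma sub_var_ty [simp]: "sub_ty V \<alpha> = \<alpha>"
  using sub_V_ty[of "\<lambda>i. i" \<alpha>] by simp

lemma ren_inst_tm: "ren_tm r (inst_tm b a) = inst_tm (ren_tm (up_ren r) b) (ren_tm r a)"
proof -
  have "(\<lambda>i. ren_tm r (case_nat a V i)) = (\<lambda>i. case_nat (ren_tm r a) V (up_ren r i))"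
    by (rule ext, case_tac i) simp_all
  then show ?thesis by simp
qed

lemma ren_inst_ty: "ren_ty r (inst_ty \<beta> a) = inst_ty (ren_ty (up_ren r) \<beta>) (ren_tm r a)"
proof -
  have "(\<lambda>i. ren_tm r (case_nat a V i)) = (\<lambda>i. case_nat (ren_tm r a) V (up_ren r i))"
    by (rule ext, case_tac i) simp_all
  then show ?thesis by simp
qed

lemma const_ty_closed [simp]: "ren_ty r (const_ty c) = const_ty c"
  by (cases c) (simp_all add: numeral_eq_Suc)

lemma comp_ren: "comp l r \<Longrightarrow> comp (ren_tm s l) (ren_tm s r)"
proof (induction rule: comp.induct)
  \<comment> \<open>In this and the other three displayed cases the right-hand side has an
    abstraction over a lifted term, so the renamed rule matches only after \<open>up_ren\<close> has
    been commuted with the lifting.\<close>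
  case (11 A B K d a f)
  show ?case
    using comp.intros(11)[of "ren_tm s A" "ren_tm s B" "ren_tm s K" "ren_tm s d" "ren_tm s a" "ren_tm s f"]
    by simp
next
  case (12 n a b)
  show ?case using comp.intros(12)[of n "ren_tm s a" "ren_tm s b"] by simp
next
  case (13 n a b)
  show ?case using comp.intros(13)[of n "ren_tm s a" "ren_tm s b"] by simp
next
  case (20 n a b)
  show ?case using comp.intros(20)[of n "ren_tm s a" "ren_tm s b"] by simp
qed (simp_all add: comp.intros)

text \<open>Puts the shift of the \<open>var\<close> rule into the lambda form on which the fusion
  rules compute.\<close>

lemma plus_Suc_eq [simp]: "(+) (Suc n) = (\<lambda>k. Suc (n + k))"
  by (rule ext) simp

text \<open>Types of variables are preserved syntactically, not just up to conversion.
  Well-formedness of the target is included because the leaf rules \<open>var\<close>,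
  \<open>const\<close> and \<open>type_SET\<close> ask for it.\<close>

definition ctx_ren :: "(nat \<Rightarrow> nat) \<Rightarrow> ty list \<Rightarrow> ty list \<Rightarrow> bool" where
  "ctx_ren r \<Gamma> \<Delta> \<longleftrightarrow> is_ctx \<Delta> \<and> (\<forall>i<length \<Gamma>. r i < length \<Delta> \<and>
     ren_ty ((+) (Suc (r i))) (\<Delta> ! r i) = ren_ty r (ren_ty ((+) (Suc i)) (\<Gamma> ! i)))"

lemma ctx_ren_up:
  assumes "ctx_ren r \<Gamma> \<Delta>" and "is_type \<Delta> (ren_ty r \<alpha>)"
  shows "ctx_ren (up_ren r) (\<alpha> # \<Gamma>) (ren_ty r \<alpha> # \<Delta>)"
  unfolding ctx_ren_def
proof (intro conjI allI impI)
  show "is_ctx (ren_ty r \<alpha> # \<Delta>)" using assms by (simp add: ctx_ren_def ctx_Cons)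
  fix i assume i: "i < length (\<alpha> # \<Gamma>)"
  show "up_ren r i < length (ren_ty r \<alpha> # \<Delta>)"
    using i assms by (cases i) (simp_all add: ctx_ren_def)
  show "ren_ty ((+) (Suc (up_ren r i))) ((ren_ty r \<alpha> # \<Delta>) ! up_ren r i) =
         ren_ty (up_ren r) (ren_ty ((+) (Suc i)) ((\<alpha> # \<Gamma>) ! i))"
  proof (cases i)
    case 0
    then show ?thesis by simp
  next
    case (Suc j)
    then have "ren_ty ((+) (Suc (r j))) (\<Delta> ! r j) = ren_ty r (ren_ty ((+) (Suc j)) (\<Gamma> ! j))"
      using i assms by (simp add: ctx_ren_def)
    then have "ren_ty Suc (ren_ty ((+) (Suc (r j))) (\<Delta> ! r j)) =
      ren_ty Suc (ren_ty r (ren_ty ((+) (Suc j)) (\<Gamma> ! j)))" by simp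
    then show ?thesis using Suc by simp
  qed
qed

lemma ctx_ren_Suc: "is_ctx (\<alpha> # \<Gamma>) \<Longrightarrow> ctx_ren Suc \<Gamma> (\<alpha> # \<Gamma>)"
  by (simp add: ctx_ren_def)

text \<open>Renaming is proved by induction on derivations. Not every rule has the well-formedness of the
  context extension it uses among its premises (\<open>eq_beta\<close> does not), so the induction carries the
  renaming property of all entries of the context.\<close>

primrec ren_ctx_ok :: "ty list \<Rightarrow> bool" where
  "ren_ctx_ok [] \<longleftrightarrow> True"
| "ren_ctx_ok (\<alpha> # \<Gamma>) \<longleftrightarrow>
     ren_ctx_ok \<Gamma> \<and> (\<forall>\<Delta> r. ctx_ren r \<Gamma> \<Delta> \<longrightarrow> is_type \<Delta> (ren_ty r \<alpha>))"

lemma renaming: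
  shows "is_ctx \<Gamma> \<Longrightarrow> ren_ctx_ok \<Gamma>"
    and "is_type \<Gamma> \<alpha> \<Longrightarrow> ren_ctx_ok \<Gamma> \<and> (\<forall>\<Delta> r. ctx_ren r \<Gamma> \<Delta> \<longrightarrow> is_type \<Delta> (ren_ty r \<alpha>))"
    and "eq_type \<Gamma> \<alpha> \<beta> \<Longrightarrow>
      ren_ctx_ok \<Gamma> \<and> (\<forall>\<Delta> r. ctx_ren r \<Gamma> \<Delta> \<longrightarrow> eq_type \<Delta> (ren_ty r \<alpha>) (ren_ty r \<beta>))"
    and "has_type \<Gamma> a \<alpha> \<Longrightarrow>
      ren_ctx_ok \<Gamma> \<and> (\<forall>\<Delta> r. ctx_ren r \<Gamma> \<Delta> \<longrightarrow> has_type \<Delta> (ren_tm r a) (ren_ty r \<alpha>))"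
    and "eq_term \<Gamma> a b \<alpha> \<Longrightarrow>
      ren_ctx_ok \<Gamma> \<and> (\<forall>\<Delta> r. ctx_ren r \<Gamma> \<Delta> \<longrightarrow> eq_term \<Delta> (ren_tm r a) (ren_tm r b) (ren_ty r \<alpha>))"
proof (induction rule: is_ctx_is_type_eq_type_has_type_eq_term.inducts)
  case (type_SET \<Gamma>)
  then show ?case by (auto simp: ctx_ren_def intro: is_ctx_is_type_eq_type_has_type_eq_term.type_SET)
next
  case (type_Fun \<Gamma> \<alpha> \<beta>)
  then show ?case by (simp, blast intro: is_ctx_is_type_eq_type_has_type_eq_term.type_Fun ctx_ren_up)
next
  case (eq_type_Fun \<Gamma> \<alpha> \<alpha>' \<beta> \<beta>')
  then show ?case by (simp, blast intro: is_ctx_is_type_eq_type_has_type_eq_term.eq_type_Fun ctx_ren_up)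
next
  case (var \<Gamma> i)
  show ?case
  proof (intro conjI allI impI)
    fix \<Delta> r assume "ctx_ren r \<Gamma> \<Delta>"
    then show "has_type \<Delta> (ren_tm r (V i)) (ren_ty r (ren_ty ((+) (Suc i)) (\<Gamma> ! i)))"
      using is_ctx_is_type_eq_type_has_type_eq_term.var[of \<Delta> "r i"] var by (simp add: ctx_ren_def)
  qed (use var in simp)
next
  case (const \<Gamma> c)
  then show ?case by (auto simp: ctx_ren_def intro: is_ctx_is_type_eq_type_has_type_eq_term.const)
next
  case (abs \<Gamma> \<alpha> b \<beta>)
  then show ?case by (simp, blast intro: is_ctx_is_type_eq_type_has_type_eq_term.abs ctx_ren_up)
next
  case (app \<Gamma> f \<alpha> \<beta> a)
  show ?case
  proof (intro conjI allI impI)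
    fix \<Delta> r assume "ctx_ren r \<Gamma> \<Delta>"
    then have "has_type \<Delta> (ren_tm r f) (ren_ty r \<alpha> \<rightarrowtail> ren_ty (up_ren r) \<beta>)"
      and "has_type \<Delta> (ren_tm r a) (ren_ty r \<alpha>)" using app by simp_all
    from is_ctx_is_type_eq_type_has_type_eq_term.app[OF this]
    show "has_type \<Delta> (ren_tm r (f \<cdot> a)) (ren_ty r (inst_ty \<beta> a))"
      unfolding ren_inst_ty by simp
  qed (use app in simp)
next
  case (eq_abs \<Gamma> \<alpha> b b' \<beta>)
  then show ?case by (simp, blast intro: is_ctx_is_type_eq_type_has_type_eq_term.eq_abs ctx_ren_up)
next
  case (eq_app \<Gamma> f f' \<alpha> \<beta> a a')
  show ?case
  proof (intro conjI allI impI)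
    fix \<Delta> r assume "ctx_ren r \<Gamma> \<Delta>"
    then have "eq_term \<Delta> (ren_tm r f) (ren_tm r f') (ren_ty r \<alpha> \<rightarrowtail> ren_ty (up_ren r) \<beta>)"
      and "eq_term \<Delta> (ren_tm r a) (ren_tm r a') (ren_ty r \<alpha>)" using eq_app by simp_all
    from is_ctx_is_type_eq_type_has_type_eq_term.eq_app[OF this]
    show "eq_term \<Delta> (ren_tm r (f \<cdot> a)) (ren_tm r (f' \<cdot> a')) (ren_ty r (inst_ty \<beta> a))"
      unfolding ren_inst_ty by simp
  qed (use eq_app in simp)
next
  case (eq_beta \<alpha> \<Gamma> b \<beta> a)
  show ?case
  proof (intro conjI allI impI)
    fix \<Delta> r assume r: "ctx_ren r \<Gamma> \<Delta>"
    then have "ctx_ren (up_ren r) (\<alpha> # \<Gamma>) (ren_ty r \<alpha> # \<Delta>)"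
      using eq_beta by (auto intro: ctx_ren_up)
    then have "has_type (ren_ty r \<alpha> # \<Delta>) (ren_tm (up_ren r) b) (ren_ty (up_ren r) \<beta>)"
      and "has_type \<Delta> (ren_tm r a) (ren_ty r \<alpha>)" using r eq_beta by simp_all
    from is_ctx_is_type_eq_type_has_type_eq_term.eq_beta[OF this]
    show "eq_term \<Delta> (ren_tm r (Abs b \<cdot> a)) (ren_tm r (inst_tm b a)) (ren_ty r (inst_ty \<beta> a))"
      unfolding ren_inst_ty ren_inst_tm by simp
  qed (use eq_beta in simp)
next
  case (eq_eta \<Gamma> f \<alpha> \<beta>)
  show ?case
  proof (intro conjI allI impI)
    fix \<Delta> r assume r: "ctx_ren r \<Gamma> \<Delta>"
    then have "has_type \<Delta> (ren_tm r f) (ren_ty r \<alpha> \<rightarrowtail> ren_ty (up_ren r) \<beta>)" using eq_eta by simp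
    from is_ctx_is_type_eq_type_has_type_eq_term.eq_eta[OF this]
    show "eq_term \<Delta> (ren_tm r (Abs (lift_tm f \<cdot> V 0))) (ren_tm r f) (ren_ty r (\<alpha> \<rightarrowtail> \<beta>))" by simp
  qed (use eq_eta in simp)
next
  case (eq_comp l r \<Gamma> \<alpha>)
  then show ?case by (auto intro: comp_ren is_ctx_is_type_eq_type_has_type_eq_term.eq_comp)
qed (simp; blast intro: is_ctx_is_type_eq_type_has_type_eq_term.intros)+

lemma weaken_has_type: "has_type \<Gamma> a \<alpha> \<Longrightarrow> is_ctx (\<delta> # \<Gamma>) \<Longrightarrow> has_type (\<delta> # \<Gamma>) (lift_tm a) (ren_ty Suc \<alpha>)"
  using renaming(4) ctx_ren_Suc by blast

section \<open>Implication and negation in type theory\<close>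

lemmas ctt = is_ctx_is_type_eq_type_has_type_eq_term.intros
lemmas ctx_Nil = is_ctx_is_type_eq_type_has_type_eq_term.ctx_Nil
lemmas ctx_Cons = is_ctx_is_type_eq_type_has_type_eq_term.ctx_Cons
lemmas type_El = is_ctx_is_type_eq_type_has_type_eq_term.type_El
lemmas type_Fun = is_ctx_is_type_eq_type_has_type_eq_term.type_Fun
lemmas eq_type_El = is_ctx_is_type_eq_type_has_type_eq_term.eq_type_El
lemmas ctt_abs = is_ctx_is_type_eq_type_has_type_eq_term.abs
lemmas ctt_conv = is_ctx_is_type_eq_type_has_type_eq_term.conv
lemmas ctt_eq_refl = is_ctx_is_type_eq_type_has_type_eq_term.eq_refl
lemmas ctt_eq_sym = is_ctx_is_type_eq_type_has_type_eq_term.eq_sym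
lemmas ctt_eq_trans = is_ctx_is_type_eq_type_has_type_eq_term.eq_trans
lemmas ctt_eq_app = is_ctx_is_type_eq_type_has_type_eq_term.eq_app
lemmas ctt_eq_beta = is_ctx_is_type_eq_type_has_type_eq_term.eq_beta
lemmas ctt_eq_comp = is_ctx_is_type_eq_type_has_type_eq_term.eq_comp

lemma context_wf:
  shows "is_ctx \<Gamma> \<Longrightarrow> True"
    and "is_type \<Gamma> \<alpha> \<Longrightarrow> is_ctx \<Gamma>"
    and "eq_type \<Gamma> \<alpha> \<beta> \<Longrightarrow> is_ctx \<Gamma>"
    and "has_type \<Gamma> a \<alpha> \<Longrightarrow> is_ctx \<Gamma>"
    and "eq_term \<Gamma> a b \<alpha> \<Longrightarrow> is_ctx \<Gamma>"
  by (induction rule: is_ctx_is_type_eq_type_has_type_eq_term.inducts) simp_all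

lemma ctx_El: "has_type \<Gamma> A SET \<Longrightarrow> is_ctx (El A # \<Gamma>)"
  by (blast intro: ctt context_wf(4))

lemma has_type_const: "is_ctx \<Gamma> \<Longrightarrow> const_ty c = \<alpha> \<Longrightarrow> has_type \<Gamma> (C c) \<alpha>"
  by (blast intro: ctt)

lemma has_type_app:
  "has_type \<Gamma> f (\<alpha> \<rightarrowtail> \<beta>) \<Longrightarrow> has_type \<Gamma> a \<alpha> \<Longrightarrow> inst_ty \<beta> a = \<gamma> \<Longrightarrow> has_type \<Gamma> (f \<cdot> a) \<gamma>"
  by (blast intro: ctt)

lemma has_type_V0: "is_ctx (\<alpha> # \<Gamma>) \<Longrightarrow> has_type (\<alpha> # \<Gamma>) (V 0) (ren_ty Suc \<alpha>)"
  using is_ctx_is_type_eq_type_has_type_eq_term.var[of "\<alpha> # \<Gamma>" 0] by simp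

lemma has_type_var:
  "is_ctx \<Gamma> \<Longrightarrow> i < length \<Gamma> \<Longrightarrow> ren_ty ((+) (Suc i)) (\<Gamma> ! i) = \<alpha> \<Longrightarrow> has_type \<Gamma> (V i) \<alpha>"
  by (blast intro: ctt)

lemma weaken_SET: "has_type \<Gamma> B SET \<Longrightarrow> is_ctx (\<delta> # \<Gamma>) \<Longrightarrow> has_type (\<delta> # \<Gamma>) (lift_tm B) SET"
  using weaken_has_type by fastforce

text \<open>Inserts \<open>\<delta>\<close> beneath the most recent assumption; this is the form
  needed to beta-reduce an abstraction that has itself been lifted.\<close>

lemma weaken_under:
  assumes "has_type (\<alpha> # \<Gamma>) b \<beta>" and "is_ctx (\<delta> # \<Gamma>)" and "is_type (\<delta> # \<Gamma>) (ren_ty Suc \<alpha>)"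
  shows "has_type (ren_ty Suc \<alpha> # \<delta> # \<Gamma>) (ren_tm (up_ren Suc) b) (ren_ty (up_ren Suc) \<beta>)"
  using renaming(4)[OF assms(1)] ctx_ren_up[OF ctx_ren_Suc[OF assms(2)] assms(3)] by blast

text \<open>Stands in for congruence of substitution: both instances are beta-expanded to
  \<open>Abs b\<close> applied to \<open>s\<close> and \<open>t\<close>, which are equal by
  congruence of application.\<close>

lemma eq_inst:
  assumes "has_type (\<alpha> # \<Gamma>) b SET" "is_type \<Gamma> \<alpha>" "eq_term \<Gamma> s t \<alpha>" "has_type \<Gamma> s \<alpha>" "has_type \<Gamma> t \<alpha>"
  shows "eq_term \<Gamma> (inst_tm b s) (inst_tm b t) SET"
proof -
  have "eq_term \<Gamma> (Abs b \<cdot> s) (inst_tm b s) SET" "eq_term \<Gamma> (Abs b \<cdot> t) (inst_tm b t) SET"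
    using ctt_eq_beta[OF assms(1)] assms(4,5) by auto
  moreover have "eq_term \<Gamma> (Abs b \<cdot> s) (Abs b \<cdot> t) SET"
    using ctt_eq_app[OF ctt_eq_refl[OF ctt_abs[OF assms(2,1)]] assms(3)] by simp
  ultimately show ?thesis by (blast intro: ctt)
qed

definition arr :: "tm \<Rightarrow> tm \<Rightarrow> tm" where "arr A B = cPi \<cdot> A \<cdot> Abs (lift_tm B)"
definition neg :: "tm \<Rightarrow> tm" where "neg A = arr A Falsum"

lemma ren_arr [simp]: "ren_tm r (arr A B) = arr (ren_tm r A) (ren_tm r B)"
  and sub_arr [simp]: "sub_tm s (arr A B) = arr (sub_tm s A) (sub_tm s B)"
  by (simp_all add: arr_def)

lemma ren_neg [simp]: "ren_tm r (neg A) = neg (ren_tm r A)"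
  and sub_neg [simp]: "sub_tm s (neg A) = neg (sub_tm s A)"
  by (simp_all add: neg_def)

lemma Not_tm_eq: "Not_tm A = neg A"
  by (simp add: Not_tm_def neg_def arr_def)

lemma Falsum_SET: "is_ctx \<Gamma> \<Longrightarrow> has_type \<Gamma> Falsum SET"
  by (simp add: has_type_const)

lemma Abs_lift:
  assumes "has_type \<Gamma> A SET" "has_type \<Gamma> B SET"
  shows "has_type \<Gamma> (Abs (lift_tm B)) (El A \<rightarrowtail> SET)"
  by (blast intro: ctt weaken_SET ctx_El assms)

lemma Abs_lift_beta:
  assumes "has_type \<Gamma> A SET" "has_type \<Gamma> B SET" "has_type \<Gamma> a (El A)"
  shows "eq_term \<Gamma> (Abs (lift_tm B) \<cdot> a) B SET"
  using ctt_eq_beta[OF weaken_SET[OF assms(2) ctx_El[OF assms(1)]] assms(3)] by simp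

lemma Pi_partial:
  assumes "has_type \<Gamma> A SET" "const_ty c = (SET \<rightarrowtail> (El (V 0) \<rightarrowtail> SET) \<rightarrowtail> SET)"
  shows "has_type \<Gamma> (C c \<cdot> A) ((El A \<rightarrowtail> SET) \<rightarrowtail> SET)"
  by (rule has_type_app[OF has_type_const[OF context_wf(4)[OF assms(1)] assms(2)] assms(1)]) simp

lemma arr_SET:
  assumes "has_type \<Gamma> A SET" "has_type \<Gamma> B SET"
  shows "has_type \<Gamma> (arr A B) SET"
  unfolding arr_def
  by (rule has_type_app[OF Pi_partial[OF assms(1)] Abs_lift[OF assms]]) simp_all

lemma neg_SET: "has_type \<Gamma> A SET \<Longrightarrow> has_type \<Gamma> (neg A) SET"
  unfolding neg_def by (blast intro: arr_SET Falsum_SET context_wf(4))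

text \<open>The type computed for the application is the constant family applied to
  \<open>a\<close>; it is only beta-equal to \<open>B\<close>, whence the final conversion.\<close>

lemma arr_app:
  assumes A: "has_type \<Gamma> A SET" and B: "has_type \<Gamma> B SET"
    and f: "has_type \<Gamma> f (El (arr A B))" and a: "has_type \<Gamma> a (El A)"
  shows "has_type \<Gamma> (cApp \<cdot> A \<cdot> Abs (lift_tm B) \<cdot> f \<cdot> a) (El B)"
proof -
  let ?B = "Abs (lift_tm B)"
  \<comment> \<open>The type of the constant is consumed one argument at a time, each display
    showing what remains. \<open>numeral_eq_Suc\<close> exposes successors in the de Bruijn indices
    so that instantiation computes.\<close>
  have "has_type \<Gamma> (C cApp) (const_ty cApp)" by (simp add: has_type_const context_wf(4)[OF A])
  from has_type_app[OF this[simplified] A refl]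
  have "has_type \<Gamma> (cApp \<cdot> A) ((El A \<rightarrowtail> SET) \<rightarrowtail> El (cPi \<cdot> lift_tm A \<cdot> V 0)
      \<rightarrowtail> El (lift_tm (lift_tm A)) \<rightarrowtail> El (V 2 \<cdot> V 0))"
    by (simp add: numeral_eq_Suc)
  from has_type_app[OF this Abs_lift[OF A B] refl]
  have "has_type \<Gamma> (cApp \<cdot> A \<cdot> ?B) (El (arr A B) \<rightarrowtail> El (lift_tm A) \<rightarrowtail> El (lift_tm (lift_tm ?B) \<cdot> V 0))"
    by (simp add: numeral_eq_Suc arr_def)
  from has_type_app[OF this f refl]
  have "has_type \<Gamma> (cApp \<cdot> A \<cdot> ?B \<cdot> f) (El A \<rightarrowtail> El (lift_tm ?B \<cdot> V 0))" by simp
  from has_type_app[OF this a refl]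
  have "has_type \<Gamma> (cApp \<cdot> A \<cdot> ?B \<cdot> f \<cdot> a) (El (?B \<cdot> a))" by simp
  then show ?thesis
    using ctt_conv eq_type_El Abs_lift_beta[OF A B a] by blast
qed

text \<open>Here the conversion goes the other way and takes place in the extended context: the body
  has type \<open>lift_tm B\<close>, while the constant expects the lifted family applied to
  \<open>V 0\<close>.\<close>

lemma arr_lam:
  assumes A: "has_type \<Gamma> A SET" and B: "has_type \<Gamma> B SET"
    and b: "has_type (El A # \<Gamma>) b (El (lift_tm B))"
  shows "has_type \<Gamma> (cLam \<cdot> A \<cdot> Abs (lift_tm B) \<cdot> Abs b) (El (arr A B))"
proof -
  let ?B = "Abs (lift_tm B)"
  note ctx = ctx_El[OF A]
  have "has_type \<Gamma> (C cLam) (const_ty cLam)" by (simp add: has_type_const context_wf(4)[OF A])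
  from has_type_app[OF this[simplified] A refl]
  have "has_type \<Gamma> (cLam \<cdot> A) ((El A \<rightarrowtail> SET) \<rightarrowtail> (El (lift_tm A) \<rightarrowtail> El (V 1 \<cdot> V 0))
      \<rightarrowtail> El (cPi \<cdot> lift_tm (lift_tm A) \<cdot> V 1))"
    by (simp add: numeral_eq_Suc)
  from has_type_app[OF this Abs_lift[OF A B] refl]
  have 1: "has_type \<Gamma> (cLam \<cdot> A \<cdot> ?B) ((El A \<rightarrowtail> El (lift_tm ?B \<cdot> V 0)) \<rightarrowtail> El (lift_tm (arr A B)))"
    by (simp add: arr_def numeral_eq_Suc)
  have "has_type (El A # \<Gamma>) (V 0) (El (lift_tm A))" using has_type_V0[OF ctx] by simp
  from Abs_lift_beta[OF weaken_SET[OF A ctx] weaken_SET[OF B ctx] this]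
  have "eq_term (El A # \<Gamma>) (lift_tm ?B \<cdot> V 0) (lift_tm B) SET" by simp
  then have "has_type (El A # \<Gamma>) b (El (lift_tm ?B \<cdot> V 0))" using b by (blast intro: ctt)
  then have 2: "has_type \<Gamma> (Abs b) (El A \<rightarrowtail> El (lift_tm ?B \<cdot> V 0))" using A by (blast intro: ctt)
  from has_type_app[OF 1 2] show ?thesis by simp
qed

text \<open>Hides proof terms, so that the next lemmas read as rules of propositional logic.
  Well-typedness of \<open>A\<close> is bundled in because nearly every rule has it as a
  premise.\<close>

definition inh :: "ty list \<Rightarrow> tm \<Rightarrow> bool" where
  "inh \<Gamma> A \<longleftrightarrow> has_type \<Gamma> A SET \<and> (\<exists>a. has_type \<Gamma> a (El A))"

lemma inh_SET: "inh \<Gamma> A \<Longrightarrow> has_type \<Gamma> A SET"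
  by (simp add: inh_def)

lemma inh_weaken: "inh \<Gamma> A \<Longrightarrow> is_ctx (\<delta> # \<Gamma>) \<Longrightarrow> inh (\<delta> # \<Gamma>) (lift_tm A)"
  unfolding inh_def using weaken_SET weaken_has_type by fastforce

lemma inh_hyp: "has_type \<Gamma> A SET \<Longrightarrow> inh (El A # \<Gamma>) (lift_tm A)"
  unfolding inh_def using weaken_SET ctx_El has_type_V0 by fastforce

lemma inh_arrI: "has_type \<Gamma> A SET \<Longrightarrow> has_type \<Gamma> B SET \<Longrightarrow> inh (El A # \<Gamma>) (lift_tm B) \<Longrightarrow> inh \<Gamma> (arr A B)"
  unfolding inh_def using arr_SET arr_lam by blast

lemma inh_arrE: "inh \<Gamma> (arr A B) \<Longrightarrow> inh \<Gamma> A \<Longrightarrow> has_type \<Gamma> B SET \<Longrightarrow> inh \<Gamma> B"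
  unfolding inh_def using arr_app by blast

lemma inh_negI: "has_type \<Gamma> A SET \<Longrightarrow> inh (El A # \<Gamma>) Falsum \<Longrightarrow> inh \<Gamma> (neg A)"
  unfolding neg_def by (rule inh_arrI) (auto intro: Falsum_SET context_wf(4))

lemma inh_negE: "inh \<Gamma> (neg A) \<Longrightarrow> inh \<Gamma> A \<Longrightarrow> inh \<Gamma> Falsum"
  unfolding neg_def by (erule inh_arrE) (auto intro: Falsum_SET context_wf(4) inh_SET)

lemma inh_const: "has_type \<Gamma> A SET \<Longrightarrow> inh \<Gamma> B \<Longrightarrow> inh \<Gamma> (arr A B)"
  by (blast intro: inh_arrI inh_weaken inh_SET ctx_El)

text \<open>Ex falso with a negated conclusion: a proof of \<open>Falsum\<close> yields
  \<open>neg B\<close> as a constant function, without the eliminator of the empty set.\<close>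

lemma inh_neg_arr_neg:
  assumes "has_type \<Gamma> A SET" "has_type \<Gamma> B SET" "inh \<Gamma> (neg A)"
  shows "inh \<Gamma> (arr A (neg B))"
proof (rule inh_arrI)
  note ctx = ctx_El[OF assms(1)]
  have "inh (El A # \<Gamma>) Falsum"
    using inh_negE inh_weaken[OF assms(3) ctx] inh_hyp[OF assms(1)] by simp
  then show "inh (El A # \<Gamma>) (lift_tm (neg B))"
    unfolding neg_def using inh_const weaken_SET[OF assms(2) ctx] by simp
qed (use assms neg_SET in auto)

lemma inh_neg_arr:
  assumes "has_type \<Gamma> B SET" "inh \<Gamma> A" "inh \<Gamma> (neg B)"
  shows "inh \<Gamma> (neg (arr A B))"
proof (rule inh_negI)
  show 1: "has_type \<Gamma> (arr A B) SET" using arr_SET inh_SET assms by blast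
  note ctx = ctx_El[OF 1]
  show "inh (El (arr A B) # \<Gamma>) Falsum"
    using inh_weaken[OF assms(2) ctx] inh_weaken[OF assms(3) ctx] inh_hyp[OF 1]
      weaken_SET[OF assms(1) ctx] inh_arrE inh_negE by fastforce
qed

lemma inh_negneg: "inh \<Gamma> A \<Longrightarrow> inh \<Gamma> (neg (neg A))"
  unfolding neg_def[of "neg A"] unfolding neg_def[of A]
  by (metis Falsum_SET context_wf(4) inh_SET inh_neg_arr inh_negI neg_def ctx_El inh_hyp ren_tm.simps(2))

text \<open>\<open>rel P Q\<close> is classically the equivalence of \<open>P\<close> and \<open>Q\<close>; stated with the negation of an
  implication in place of a conjunction, it needs no products.\<close>

definition rel :: "tm \<Rightarrow> tm \<Rightarrow> tm" where
  "rel P Q = neg (arr (arr (neg P) (neg Q)) (neg (arr (neg Q) (neg P))))"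

lemma ren_rel [simp]: "ren_tm r (rel P Q) = rel (ren_tm r P) (ren_tm r Q)"
  and sub_rel [simp]: "sub_tm s (rel P Q) = rel (sub_tm s P) (sub_tm s Q)"
  by (simp_all add: rel_def)

lemma rel_SET: "has_type \<Gamma> P SET \<Longrightarrow> has_type \<Gamma> Q SET \<Longrightarrow> has_type \<Gamma> (rel P Q) SET"
  unfolding rel_def by (intro neg_SET arr_SET)

lemma inh_relI:
  assumes "inh \<Gamma> (arr (neg P) (neg Q))" "inh \<Gamma> (arr (neg Q) (neg P))"
  shows "inh \<Gamma> (rel P Q)"
  unfolding rel_def
  by (intro inh_neg_arr inh_negneg neg_SET assms) (use assms inh_SET in blast)

text \<open>Asking only for \<open>\<not>\<not>P\<close> makes this fit the left disjunct of De
  Morgan's law. Each implication between negations has a refutable premise.\<close>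

lemma inh_rel_true:
  "has_type \<Gamma> P SET \<Longrightarrow> inh \<Gamma> (neg (neg P)) \<Longrightarrow> inh \<Gamma> Q \<Longrightarrow> inh \<Gamma> (rel P Q)"
  by (rule inh_relI; rule inh_neg_arr_neg) (auto intro: inh_SET neg_SET inh_negneg)

lemma inh_rel_false:
  "has_type \<Gamma> P SET \<Longrightarrow> has_type \<Gamma> Q SET \<Longrightarrow> inh \<Gamma> (neg P) \<Longrightarrow> inh \<Gamma> (neg Q) \<Longrightarrow> inh \<Gamma> (rel P Q)"
  by (intro inh_relI inh_const neg_SET)

text \<open>Since \<open>rel\<close> is a negation, it can only be used to reach
  \<open>Falsum\<close>. Under \<open>neg Q\<close>, the proof of \<open>P\<close> refutes
  \<open>neg Q \<rightarrow> neg P\<close>, which contradicts \<open>rel P Q\<close>.\<close>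

lemma inh_rel_true_D:
  assumes "inh \<Gamma> (rel P Q)" "inh \<Gamma> P" "has_type \<Gamma> Q SET"
  shows "inh \<Gamma> (neg (neg Q))"
proof (rule inh_negI)
  show Q: "has_type \<Gamma> (neg Q) SET" using assms neg_SET by blast
  note ctx = ctx_El[OF Q]
  let ?\<Delta> = "El (neg Q) # \<Gamma>" and ?P = "lift_tm P" and ?Q = "lift_tm Q"
  have P: "inh ?\<Delta> (neg (neg ?P))" using inh_negneg inh_weaken[OF assms(2) ctx] by simp
  have PT: "has_type ?\<Delta> ?P SET" using inh_SET inh_weaken[OF assms(2) ctx] by blast
  have nQ: "inh ?\<Delta> (neg ?Q)" using inh_hyp[OF Q] by simp
  have "inh ?\<Delta> (neg (arr (neg ?Q) (neg ?P)))" by (rule inh_neg_arr[OF neg_SET[OF PT] nQ P])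
  then have "inh ?\<Delta> (arr (arr (neg ?P) (neg ?Q)) (neg (arr (neg ?Q) (neg ?P))))"
    using inh_const arr_SET neg_SET[OF PT] inh_SET[OF nQ] by blast
  then show "inh ?\<Delta> Falsum"
    using inh_negE inh_weaken[OF assms(1) ctx] by (simp add: rel_def)
qed

lemma inh_rel_false_D:
  assumes "inh \<Gamma> (rel P Q)" "inh \<Gamma> (neg P)" "has_type \<Gamma> P SET" "has_type \<Gamma> Q SET"
  shows "inh \<Gamma> (neg Q)"
proof (rule inh_negI)
  show Q: "has_type \<Gamma> Q SET" by fact
  note ctx = ctx_El[OF Q]
  let ?\<Delta> = "El Q # \<Gamma>" and ?P = "lift_tm P" and ?Q = "lift_tm Q"
  have nnQ: "inh ?\<Delta> (neg (neg ?Q))" using inh_negneg inh_hyp[OF Q] by simp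
  have nP: "inh ?\<Delta> (neg ?P)" using inh_weaken[OF assms(2) ctx] by simp
  have PT: "has_type ?\<Delta> ?P SET" and QT: "has_type ?\<Delta> ?Q SET" using assms weaken_SET[OF _ ctx] by blast+
  \<comment> \<open>Dually to the previous lemma it is now the first implication that fails, so the
    implication negated by \<open>rel\<close> holds by ex falso.\<close>
  have "inh ?\<Delta> (neg (arr (neg ?P) (neg ?Q)))" by (rule inh_neg_arr[OF neg_SET[OF QT] nP nnQ])
  then have "inh ?\<Delta> (arr (arr (neg ?P) (neg ?Q)) (neg (arr (neg ?Q) (neg ?P))))"
    by (intro inh_neg_arr_neg arr_SET neg_SET PT QT)
  then show "inh ?\<Delta> Falsum"
    using inh_negE inh_weaken[OF assms(1) ctx] by (simp add: rel_def)
qed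

text \<open>The body \<open>rel (lift_tm P) (V 0)\<close> is instantiated at both terms, which
  avoids descending through the structure of \<open>rel\<close>.\<close>

lemma rel_cong:
  assumes "eq_term \<Gamma> X Y SET" "has_type \<Gamma> X SET" "has_type \<Gamma> Y SET" "has_type \<Gamma> P SET"
  shows "eq_term \<Gamma> (rel P X) (rel P Y) SET"
proof -
  have T: "is_type \<Gamma> SET" using assms context_wf(4) by (blast intro: ctt)
  have ctx: "is_ctx (SET # \<Gamma>)" using T context_wf(2) by (blast intro: ctt)
  have "has_type (SET # \<Gamma>) (rel (lift_tm P) (V 0)) SET"
    using rel_SET weaken_SET[OF assms(4) ctx] has_type_V0[OF ctx] by simp
  from eq_inst[OF this T assms(1-3)] show ?thesis by simp
qed

section \<open>Truth values in the universe\<close>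

text \<open>For replacing variable 0 of a family by a term that lives under one additional
  assumption: the other variables step over that assumption.\<close>

abbreviation "inst_under b a \<equiv> sub_tm (case_nat a (\<lambda>i. V (Suc i))) b"

section \<open>Disjoint unions and their dependent elimination\<close>

lemma Plus_SET:
  assumes "has_type \<Gamma> A SET" "has_type \<Gamma> B SET"
  shows "has_type \<Gamma> (cPlus \<cdot> A \<cdot> B) SET"
proof -
  have "has_type \<Gamma> (C cPlus) (SET \<rightarrowtail> SET \<rightarrowtail> SET)" by (simp add: has_type_const context_wf(4)[OF assms(1)])
  from has_type_app[OF has_type_app[OF this assms(1) refl, simplified] assms(2)] show ?thesis by simp
qed

lemma Inl_type:
  assumes A: "has_type \<Gamma> A SET" and B: "has_type \<Gamma> B SET" and a: "has_type \<Gamma> a (El A)"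
  shows "has_type \<Gamma> (cInl \<cdot> A \<cdot> B \<cdot> a) (El (cPlus \<cdot> A \<cdot> B))"
proof -
  have "has_type \<Gamma> (C cInl) (const_ty cInl)" by (simp add: has_type_const context_wf(4)[OF A])
  from has_type_app[OF has_type_app[OF this[simplified] A refl, simplified] B refl]
  have "has_type \<Gamma> (cInl \<cdot> A \<cdot> B) (El A \<rightarrowtail> El (lift_tm (cPlus \<cdot> A \<cdot> B)))"
    by (simp add: numeral_eq_Suc)
  from has_type_app[OF this a refl] show ?thesis by simp
qed

lemma Inr_type:
  assumes A: "has_type \<Gamma> A SET" and B: "has_type \<Gamma> B SET" and a: "has_type \<Gamma> a (El B)"
  shows "has_type \<Gamma> (cInr \<cdot> A \<cdot> B \<cdot> a) (El (cPlus \<cdot> A \<cdot> B))"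
proof -
  have "has_type \<Gamma> (C cInr) (const_ty cInr)" by (simp add: has_type_const context_wf(4)[OF A])
  from has_type_app[OF has_type_app[OF this[simplified] A refl, simplified] B refl]
  have "has_type \<Gamma> (cInr \<cdot> A \<cdot> B) (El B \<rightarrowtail> El (lift_tm (cPlus \<cdot> A \<cdot> B)))"
    by (simp add: numeral_eq_Suc)
  from has_type_app[OF this a refl] show ?thesis by simp
qed

lemma When_fam:
  assumes A: "has_type \<Gamma> A SET" and B: "has_type \<Gamma> B SET"
    and K: "has_type \<Gamma> K (El (cPlus \<cdot> A \<cdot> B) \<rightarrowtail> SET)"
    and d: "has_type \<Gamma> d (El A \<rightarrowtail> El (lift_tm K \<cdot> (cInl \<cdot> lift_tm A \<cdot> lift_tm B \<cdot> V 0)))"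
    and e: "has_type \<Gamma> e (El B \<rightarrowtail> El (lift_tm K \<cdot> (cInr \<cdot> lift_tm A \<cdot> lift_tm B \<cdot> V 0)))"
    and c: "has_type \<Gamma> c (El (cPlus \<cdot> A \<cdot> B))"
  shows "has_type \<Gamma> (cWhen \<cdot> A \<cdot> B \<cdot> K \<cdot> d \<cdot> e \<cdot> c) (El (K \<cdot> c))"
proof -
  have "has_type \<Gamma> (C cWhen) (const_ty cWhen)" by (simp add: has_type_const context_wf(4)[OF A])
  from has_type_app[OF has_type_app[OF has_type_app[OF this[simplified] A refl, simplified] B refl, simplified]
      K refl]
  have "has_type \<Gamma> (cWhen \<cdot> A \<cdot> B \<cdot> K)
    ((El A \<rightarrowtail> El (lift_tm K \<cdot> (cInl \<cdot> lift_tm A \<cdot> lift_tm B \<cdot> V 0))) \<rightarrowtail>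
     (El (lift_tm B) \<rightarrowtail> El (lift_tm (lift_tm K) \<cdot> (cInr \<cdot> lift_tm (lift_tm A) \<cdot> lift_tm (lift_tm B) \<cdot> V 0))) \<rightarrowtail>
     El (lift_tm (lift_tm (cPlus \<cdot> A \<cdot> B))) \<rightarrowtail> El (lift_tm (lift_tm (lift_tm K)) \<cdot> V 0))"
    by (simp add: numeral_eq_Suc)
  from has_type_app[OF this d refl]
  have "has_type \<Gamma> (cWhen \<cdot> A \<cdot> B \<cdot> K \<cdot> d)
    ((El B \<rightarrowtail> El (lift_tm K \<cdot> (cInr \<cdot> lift_tm A \<cdot> lift_tm B \<cdot> V 0))) \<rightarrowtail>
     El (lift_tm (cPlus \<cdot> A \<cdot> B)) \<rightarrowtail> El (lift_tm (lift_tm K) \<cdot> V 0))"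
    by simp
  from has_type_app[OF this e refl]
  have "has_type \<Gamma> (cWhen \<cdot> A \<cdot> B \<cdot> K \<cdot> d \<cdot> e) (El (cPlus \<cdot> A \<cdot> B) \<rightarrowtail> El (lift_tm K \<cdot> V 0))"
    by simp
  from has_type_app[OF this c refl] show ?thesis by simp
qed

lemma Abs_beta_lifted:
  assumes P: "has_type \<Gamma> P SET" and A: "has_type \<Gamma> A SET" and K: "has_type (El P # \<Gamma>) K SET"
    and t: "has_type (El A # \<Gamma>) t (El (lift_tm P))"
  shows "eq_term (El A # \<Gamma>) (lift_tm (Abs K) \<cdot> t) (inst_under K t) SET"
proof -
  have "is_type (El A # \<Gamma>) (ren_ty Suc (El P))"
    using weaken_SET[OF P ctx_El[OF A]] by (auto intro: ctt)
  from ctt_eq_beta[OF weaken_under[OF K ctx_El[OF A] this]] t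
  have "eq_term (El A # \<Gamma>) (lift_tm (Abs K) \<cdot> t) (inst_tm (ren_tm (up_ren Suc) K) t) SET" by simp
  moreover have "(\<lambda>i. case_nat t V (up_ren Suc i)) = case_nat t (\<lambda>i. V (Suc i))"
    by (rule ext, case_tac i) simp_all
  ultimately show ?thesis by simp
qed

text \<open>Version of the eliminator in which the motive is an open term and all types are
  beta-reduced; \<open>Abs_beta_lifted\<close> converts the types of the two branches.\<close>

lemma When_type:
  assumes A: "has_type \<Gamma> A SET" and B: "has_type \<Gamma> B SET"
    and K: "has_type (El (cPlus \<cdot> A \<cdot> B) # \<Gamma>) K SET"
    and d: "has_type (El A # \<Gamma>) d (El (inst_under K (cInl \<cdot> lift_tm A \<cdot> lift_tm B \<cdot> V 0)))"
    and e: "has_type (El B # \<Gamma>) e (El (inst_under K (cInr \<cdot> lift_tm A \<cdot> lift_tm B \<cdot> V 0)))"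
    and c: "has_type \<Gamma> c (El (cPlus \<cdot> A \<cdot> B))"
  shows "has_type \<Gamma> (cWhen \<cdot> A \<cdot> B \<cdot> Abs K \<cdot> Abs d \<cdot> Abs e \<cdot> c) (El (inst_tm K c))"
proof -
  note P = Plus_SET[OF A B]
  have 1: "has_type (El A # \<Gamma>) (cInl \<cdot> lift_tm A \<cdot> lift_tm B \<cdot> V 0) (El (lift_tm (cPlus \<cdot> A \<cdot> B)))"
    using Inl_type[OF weaken_SET[OF A ctx_El[OF A]] weaken_SET[OF B ctx_El[OF A]]]
      has_type_V0[OF ctx_El[OF A]] by simp
  have 2: "has_type (El B # \<Gamma>) (cInr \<cdot> lift_tm A \<cdot> lift_tm B \<cdot> V 0) (El (lift_tm (cPlus \<cdot> A \<cdot> B)))"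
    using Inr_type[OF weaken_SET[OF A ctx_El[OF B]] weaken_SET[OF B ctx_El[OF B]]]
      has_type_V0[OF ctx_El[OF B]] by simp
  have "has_type \<Gamma> (Abs K) (El (cPlus \<cdot> A \<cdot> B) \<rightarrowtail> SET)" using P K by (blast intro: ctt)
  moreover have "has_type \<Gamma> (Abs d) (El A \<rightarrowtail> El (lift_tm (Abs K) \<cdot> (cInl \<cdot> lift_tm A \<cdot> lift_tm B \<cdot> V 0)))"
    using ctt_abs[OF type_El[OF A] ctt_conv[OF d eq_type_El[OF ctt_eq_sym[OF Abs_beta_lifted[OF P A K 1]]]]] .
  moreover have "has_type \<Gamma> (Abs e) (El B \<rightarrowtail> El (lift_tm (Abs K) \<cdot> (cInr \<cdot> lift_tm A \<cdot> lift_tm B \<cdot> V 0)))"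
    using ctt_abs[OF type_El[OF B] ctt_conv[OF e eq_type_El[OF ctt_eq_sym[OF Abs_beta_lifted[OF P B K 2]]]]] .
  ultimately have "has_type \<Gamma> (cWhen \<cdot> A \<cdot> B \<cdot> Abs K \<cdot> Abs d \<cdot> Abs e \<cdot> c) (El (Abs K \<cdot> c))"
    by (rule When_fam[OF A B _ _ _ c])
  moreover have "eq_term \<Gamma> (Abs K \<cdot> c) (inst_tm K c) SET" using ctt_eq_beta[OF K c] by simp
  ultimately show ?thesis by (blast intro: ctt)
qed

text \<open>The truth value read off from a proof \<open>q\<close> of a disjunction, by elimination
  into the constant family \<open>cU 0\<close>: the code of the one-element set on the left, of the
  empty set on the right.\<close>

definition sel :: "tm \<Rightarrow> tm \<Rightarrow> tm \<Rightarrow> tm" where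
  "sel A B q = cWhen \<cdot> A \<cdot> B \<cdot> Abs (cU 0) \<cdot> Abs (cuN1 0) \<cdot> Abs (cuN0 0) \<cdot> q"

lemma ren_sel [simp]: "ren_tm r (sel A B q) = sel (ren_tm r A) (ren_tm r B) (ren_tm r q)"
  and sub_sel [simp]: "sub_tm s (sel A B q) = sel (sub_tm s A) (sub_tm s B) (sub_tm s q)"
  by (simp_all add: sel_def)

lemma sel_type:
  assumes "has_type \<Gamma> A SET" "has_type \<Gamma> B SET" "has_type \<Gamma> q (El (cPlus \<cdot> A \<cdot> B))"
  shows "has_type \<Gamma> (sel A B q) (El (cU 0))"
  unfolding sel_def
  using When_type[OF assms(1,2) _ _ _ assms(3), of "C (cU 0)" "C (cuN1 0)" "C (cuN0 0)"]
  by (simp add: has_type_const ctx_El assms Plus_SET)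

lemma Abs_const_beta:
  assumes "has_type \<Gamma> A SET" "has_type \<Gamma> a (El A)" "const_ty c = El (cU 0)"
  shows "eq_term \<Gamma> (Abs (C c) \<cdot> a) (C c) (El (cU 0))" "has_type \<Gamma> (Abs (C c) \<cdot> a) (El (cU 0))"
proof -
  have c: "has_type (El A # \<Gamma>) (C c) (El (cU 0))"
    using has_type_const[OF ctx_El[OF assms(1)] assms(3)] by simp
  show "eq_term \<Gamma> (Abs (C c) \<cdot> a) (C c) (El (cU 0))" using ctt_eq_beta[OF c assms(2)] by simp
  show "has_type \<Gamma> (Abs (C c) \<cdot> a) (El (cU 0))"
    using has_type_app[OF ctt_abs[OF type_El[OF assms(1)] c] assms(2)] by simp
qed

text \<open>One computation step followed by one beta step. The computation rule requires both of
  its sides to be typed, which is the purpose of the second part of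
  \<open>Abs_const_beta\<close>.\<close>

lemma sel_Inl:
  assumes "has_type \<Gamma> A SET" "has_type \<Gamma> B SET" "has_type \<Gamma> a (El A)"
  shows "eq_term \<Gamma> (sel A B (cInl \<cdot> A \<cdot> B \<cdot> a)) (cuN1 0) (El (cU 0))"
proof (rule ctt_eq_trans)
  show "eq_term \<Gamma> (sel A B (cInl \<cdot> A \<cdot> B \<cdot> a)) (Abs (cuN1 0) \<cdot> a) (El (cU 0))"
    unfolding sel_def
    by (rule ctt_eq_comp[OF comp.intros(3) sel_type[unfolded sel_def] Abs_const_beta(2)[OF assms(1,3)]])
      (auto intro: assms Inl_type)
qed (rule Abs_const_beta(1)[OF assms(1,3)], simp)

lemma sel_Inr:
  assumes "has_type \<Gamma> A SET" "has_type \<Gamma> B SET" "has_type \<Gamma> a (El B)"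
  shows "eq_term \<Gamma> (sel A B (cInr \<cdot> A \<cdot> B \<cdot> a)) (cuN0 0) (El (cU 0))"
proof (rule ctt_eq_trans)
  show "eq_term \<Gamma> (sel A B (cInr \<cdot> A \<cdot> B \<cdot> a)) (Abs (cuN0 0) \<cdot> a) (El (cU 0))"
    unfolding sel_def
    by (rule ctt_eq_comp[OF comp.intros(4) sel_type[unfolded sel_def] Abs_const_beta(2)[OF assms(2,3)]])
      (auto intro: assms Inr_type)
qed (rule Abs_const_beta(1)[OF assms(2,3)], simp)

abbreviation dec :: "tm \<Rightarrow> tm" where "dec i \<equiv> cT 0 \<cdot> i"

lemma cT_type: "is_ctx \<Gamma> \<Longrightarrow> has_type \<Gamma> (cT n) (El (cU n) \<rightarrowtail> SET)"
  by (simp add: has_type_const)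

lemma dec_SET: "has_type \<Gamma> i (El (cU 0)) \<Longrightarrow> has_type \<Gamma> (dec i) SET"
  by (rule has_type_app[OF cT_type]) (simp_all add: context_wf(4))

lemma dec_cong: "eq_term \<Gamma> i j (El (cU 0)) \<Longrightarrow> eq_term \<Gamma> (dec i) (dec j) SET"
  using ctt_eq_app[OF ctt_eq_refl[OF cT_type]] context_wf(5) by fastforce

lemma dec_N1: "is_ctx \<Gamma> \<Longrightarrow> eq_term \<Gamma> (dec (cuN1 0)) cN1 SET"
  by (rule ctt_eq_comp[OF comp.intros(17) dec_SET]) (simp_all add: has_type_const)

lemma dec_N0: "is_ctx \<Gamma> \<Longrightarrow> eq_term \<Gamma> (dec (cuN0 0)) Falsum SET"
  by (rule ctt_eq_comp[OF comp.intros(16) dec_SET]) (simp_all add: has_type_const)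

lemma inh_N1: "is_ctx \<Gamma> \<Longrightarrow> inh \<Gamma> cN1"
  unfolding inh_def using has_type_const[of \<Gamma> cElem1 "El cN1"] has_type_const[of \<Gamma> cN1 SET] by auto

lemma inh_not_Falsum: "is_ctx \<Gamma> \<Longrightarrow> inh \<Gamma> (neg Falsum)"
  by (rule inh_negI) (use Falsum_SET inh_hyp in fastforce)+

lemma inh_conv: "inh \<Gamma> A \<Longrightarrow> eq_term \<Gamma> A B SET \<Longrightarrow> has_type \<Gamma> B SET \<Longrightarrow> inh \<Gamma> B"
  unfolding inh_def by (blast intro: ctt)

text \<open>The term \<open>q\<close> need not reduce to an injection (it will be the law applied to
  a variable), so the statement is generalised to a family \<open>?K\<close> over the whole
  disjunction and proved by \<open>cWhen\<close>. In each branch \<open>sel\<close>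
  computes.\<close>

lemma inh_rel_sel:
  assumes P: "has_type \<Gamma> P SET" and q: "has_type \<Gamma> q (El (cPlus \<cdot> neg (neg P) \<cdot> neg P))"
  shows "inh \<Gamma> (rel P (dec (sel (neg (neg P)) (neg P) q)))"
proof -
  let ?A = "neg (neg P)" and ?B = "neg P"
  have A: "has_type \<Gamma> ?A SET" and B: "has_type \<Gamma> ?B SET" using neg_SET P by blast+
  note PT = Plus_SET[OF A B]
  let ?K = "rel (lift_tm P) (dec (sel (lift_tm ?A) (lift_tm ?B) (V 0)))"
  let ?K' = "\<lambda>t. rel (lift_tm P) (dec (sel (lift_tm ?A) (lift_tm ?B) t))"
  have lifted: "has_type (El D # \<Gamma>) (lift_tm P) SET"
      "has_type (El D # \<Gamma>) (lift_tm ?A) SET" "has_type (El D # \<Gamma>) (lift_tm ?B) SET"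
    if "has_type \<Gamma> D SET" for D
    using weaken_SET[OF _ ctx_El[OF that]] P A B by blast+
  have V0: "has_type (El D # \<Gamma>) (V 0) (El (lift_tm D))" if "has_type \<Gamma> D SET" for D
    using has_type_V0[OF ctx_El[OF that]] by simp
  have K': "has_type (El D # \<Gamma>) (?K' t) SET"
    if "has_type \<Gamma> D SET" "has_type (El D # \<Gamma>) t (El (cPlus \<cdot> lift_tm ?A \<cdot> lift_tm ?B))" for D t
    by (intro rel_SET dec_SET sel_type lifted that)
  have K: "has_type (El (cPlus \<cdot> ?A \<cdot> ?B) # \<Gamma>) ?K SET"
    by (rule K'[OF PT]) (use V0[OF PT] in simp)
  let ?l = "cInl \<cdot> lift_tm ?A \<cdot> lift_tm ?B \<cdot> V 0" and ?r = "cInr \<cdot> lift_tm ?A \<cdot> lift_tm ?B \<cdot> V 0"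
  have "inh (El ?A # \<Gamma>) (?K' ?l)"
  proof (rule inh_conv)
    note ctx = ctx_El[OF A]
    have l: "has_type (El ?A # \<Gamma>) ?l (El (cPlus \<cdot> lift_tm ?A \<cdot> lift_tm ?B))"
      by (intro Inl_type lifted V0 A)
    \<comment> \<open>The branch assumption is \<open>\<not>\<not>P\<close>, and the selected code
      decodes to the true proposition \<open>cN1\<close>.\<close>
    show "inh (El ?A # \<Gamma>) (rel (lift_tm P) cN1)"
      using inh_rel_true[OF lifted(1)[OF A]] inh_hyp[OF A] inh_N1[OF ctx] by simp
    show "has_type (El ?A # \<Gamma>) (?K' ?l) SET" by (rule K'[OF A l])
    have "eq_term (El ?A # \<Gamma>) (dec (sel (lift_tm ?A) (lift_tm ?B) ?l)) cN1 SET"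
      using dec_cong[OF sel_Inl[OF lifted(2)[OF A] lifted(3)[OF A] V0[OF A]]] dec_N1[OF ctx] by (blast intro: ctt)
    then show "eq_term (El ?A # \<Gamma>) (rel (lift_tm P) cN1) (?K' ?l) SET"
      by (intro rel_cong dec_SET sel_type lifted A l)
        (auto intro: ctt inh_SET inh_N1 ctx)
  qed
  then obtain d where d: "has_type (El ?A # \<Gamma>) d (El (?K' ?l))" unfolding inh_def by blast
  have "inh (El ?B # \<Gamma>) (?K' ?r)"
  proof (rule inh_conv)
    note ctx = ctx_El[OF B]
    have r: "has_type (El ?B # \<Gamma>) ?r (El (cPlus \<cdot> lift_tm ?A \<cdot> lift_tm ?B))"
      by (intro Inr_type lifted V0 B)
    \<comment> \<open>The branch assumption is \<open>\<not>P\<close>, and the selected code decodes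
      to \<open>Falsum\<close>.\<close>
    show "inh (El ?B # \<Gamma>) (rel (lift_tm P) Falsum)"
      using inh_rel_false[OF lifted(1)[OF B] Falsum_SET[OF ctx]] inh_hyp[OF B] inh_not_Falsum[OF ctx] by simp
    show "has_type (El ?B # \<Gamma>) (?K' ?r) SET" by (rule K'[OF B r])
    have "eq_term (El ?B # \<Gamma>) (dec (sel (lift_tm ?A) (lift_tm ?B) ?r)) Falsum SET"
      using dec_cong[OF sel_Inr[OF lifted(2)[OF B] lifted(3)[OF B] V0[OF B]]] dec_N0[OF ctx] by (blast intro: ctt)
    then show "eq_term (El ?B # \<Gamma>) (rel (lift_tm P) Falsum) (?K' ?r) SET"
      by (intro rel_cong dec_SET sel_type lifted B r)
        (auto intro: ctt Falsum_SET ctx)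
  qed
  then obtain e where e: "has_type (El ?B # \<Gamma>) e (El (?K' ?r))" unfolding inh_def by blast
  have "has_type \<Gamma> (cWhen \<cdot> ?A \<cdot> ?B \<cdot> Abs ?K \<cdot> Abs d \<cdot> Abs e \<cdot> q) (El (inst_tm ?K q))"
    by (rule When_type[OF A B K _ _ q]) (use d e in simp_all)
  then show ?thesis unfolding inh_def
    using rel_SET[OF P dec_SET[OF sel_type[OF A B q]]] by auto
qed

section \<open>The uniformity principle applied to \<open>rel\<close>\<close>

lemma GUP_apply:
  assumes g: "has_type \<Gamma> g GUP_elem_ty" and I: "has_type \<Gamma> I SET"
    and R: "has_type \<Gamma> R (SET \<rightarrowtail> El (lift_tm I) \<rightarrowtail> SET)"
    and F: "has_type \<Gamma> F (SET \<rightarrowtail> El (lift_tm I))"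
    and h: "has_type \<Gamma> h (SET \<rightarrowtail> El (lift_tm R \<cdot> V 0 \<cdot> (lift_tm F \<cdot> V 0)))"
  shows "has_type \<Gamma> (g \<cdot> I \<cdot> R \<cdot> F \<cdot> h) (El I)"
proof -
  from has_type_app[OF g[unfolded GUP_elem_ty_def] I refl]
  have "has_type \<Gamma> (g \<cdot> I) ((SET \<rightarrowtail> El (lift_tm I) \<rightarrowtail> SET) \<rightarrowtail> (SET \<rightarrowtail> El (lift_tm (lift_tm I)))
     \<rightarrowtail> (SET \<rightarrowtail> El (V 2 \<cdot> V 0 \<cdot> (V 1 \<cdot> V 0))) \<rightarrowtail> El (lift_tm (lift_tm (lift_tm I))))"
    by (simp add: numeral_eq_Suc)
  from has_type_app[OF this R refl]
  have "has_type \<Gamma> (g \<cdot> I \<cdot> R) ((SET \<rightarrowtail> El (lift_tm I))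
     \<rightarrowtail> (SET \<rightarrowtail> El (lift_tm (lift_tm R) \<cdot> V 0 \<cdot> (V 1 \<cdot> V 0))) \<rightarrowtail> El (lift_tm (lift_tm I)))"
    by (simp add: numeral_eq_Suc)
  from has_type_app[OF this F refl]
  have "has_type \<Gamma> (g \<cdot> I \<cdot> R \<cdot> F)
    ((SET \<rightarrowtail> El (lift_tm R \<cdot> V 0 \<cdot> (lift_tm F \<cdot> V 0))) \<rightarrowtail> El (lift_tm I))"
    by (simp add: numeral_eq_Suc)
  from has_type_app[OF this h refl] show ?thesis by simp
qed

lemma GUP_proof_apply:
  assumes g: "has_type \<Gamma> g' (inst_ty GUP_proof_ty g)" and I: "has_type \<Gamma> I SET"
    and R: "has_type \<Gamma> R (SET \<rightarrowtail> El (lift_tm I) \<rightarrowtail> SET)"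
    and F: "has_type \<Gamma> F (SET \<rightarrowtail> El (lift_tm I))"
    and h: "has_type \<Gamma> h (SET \<rightarrowtail> El (lift_tm R \<cdot> V 0 \<cdot> (lift_tm F \<cdot> V 0)))"
    and P: "has_type \<Gamma> P SET"
  shows "has_type \<Gamma> (g' \<cdot> I \<cdot> R \<cdot> F \<cdot> h \<cdot> P) (El (R \<cdot> P \<cdot> (g \<cdot> I \<cdot> R \<cdot> F \<cdot> h)))"
proof -
  from has_type_app[OF g[unfolded GUP_proof_ty_def, simplified] I refl]
  have "has_type \<Gamma> (g' \<cdot> I) ((SET \<rightarrowtail> El (lift_tm I) \<rightarrowtail> SET) \<rightarrowtail> (SET \<rightarrowtail> El (lift_tm (lift_tm I)))
     \<rightarrowtail> (SET \<rightarrowtail> El (V 2 \<cdot> V 0 \<cdot> (V 1 \<cdot> V 0))) \<rightarrowtail> SET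
     \<rightarrowtail> El (V 3 \<cdot> V 0 \<cdot> (lift_tm (lift_tm (lift_tm (lift_tm g))) \<cdot> lift_tm (lift_tm (lift_tm (lift_tm I))) \<cdot> V 3 \<cdot> V 2 \<cdot> V 1)))"
    by (simp add: numeral_eq_Suc)
  from has_type_app[OF this R refl]
  have "has_type \<Gamma> (g' \<cdot> I \<cdot> R) ((SET \<rightarrowtail> El (lift_tm I))
     \<rightarrowtail> (SET \<rightarrowtail> El (lift_tm (lift_tm R) \<cdot> V 0 \<cdot> (V 1 \<cdot> V 0))) \<rightarrowtail> SET
     \<rightarrowtail> El (lift_tm (lift_tm (lift_tm R)) \<cdot> V 0 \<cdot> (lift_tm (lift_tm (lift_tm (g \<cdot> I \<cdot> R))) \<cdot> V 2 \<cdot> V 1)))"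
    by (simp add: numeral_eq_Suc)
  from has_type_app[OF this F refl]
  have "has_type \<Gamma> (g' \<cdot> I \<cdot> R \<cdot> F) ((SET \<rightarrowtail> El (lift_tm R \<cdot> V 0 \<cdot> (lift_tm F \<cdot> V 0))) \<rightarrowtail> SET
     \<rightarrowtail> El (lift_tm (lift_tm R) \<cdot> V 0 \<cdot> (lift_tm (lift_tm (g \<cdot> I \<cdot> R \<cdot> F)) \<cdot> V 1)))"
    by (simp add: numeral_eq_Suc)
  from has_type_app[OF this h refl]
  have "has_type \<Gamma> (g' \<cdot> I \<cdot> R \<cdot> F \<cdot> h) (SET \<rightarrowtail> El (lift_tm R \<cdot> V 0 \<cdot> lift_tm (g \<cdot> I \<cdot> R \<cdot> F \<cdot> h)))"
    by simp
  from has_type_app[OF this P refl] show ?thesis by simp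
qed

lemma is_type_SET: "is_ctx \<Gamma> \<Longrightarrow> is_type \<Gamma> SET"
  by (blast intro: ctt)

lemma ctx_SET: "is_ctx \<Gamma> \<Longrightarrow> is_ctx (SET # \<Gamma>)"
  by (blast intro: ctt)

text \<open>The principle wants its relation as a function of the framework; applied to
  \<open>P\<close> and \<open>i\<close>, this function is convertible to
  \<open>rel P (dec i)\<close> but not identical with it.\<close>

lemma rel_fam_beta:
  assumes P: "has_type \<Gamma> P SET" and i: "has_type \<Gamma> i (El (cU 0))"
  shows "eq_term \<Gamma> (Abs (Abs (rel (V 1) (dec (V 0)))) \<cdot> P \<cdot> i) (rel P (dec i)) SET"
    and "has_type \<Gamma> (Abs (Abs (rel (V 1) (dec (V 0))))) (SET \<rightarrowtail> El (cU 0) \<rightarrowtail> SET)"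
proof -
  note ctx = ctx_SET[OF context_wf(4)[OF P]]
  have U: "has_type \<Delta> (cU 0) SET" if "is_ctx \<Delta>" for \<Delta> using that by (simp add: has_type_const)
  note ctx2 = ctx_El[OF U[OF ctx]]
  have "has_type (El (cU 0) # SET # \<Gamma>) (V 1) SET" "has_type (El (cU 0) # SET # \<Gamma>) (V 0) (El (cU 0))"
    using has_type_var[OF ctx2] by simp_all
  then have b: "has_type (El (cU 0) # SET # \<Gamma>) (rel (V 1) (dec (V 0))) SET"
    by (intro rel_SET dec_SET)
  have ab: "has_type (SET # \<Gamma>) (Abs (rel (V 1) (dec (V 0)))) (El (cU 0) \<rightarrowtail> SET)"
    by (rule ctt_abs[OF type_El[OF U[OF ctx]] b])
  show "has_type \<Gamma> (Abs (Abs (rel (V 1) (dec (V 0))))) (SET \<rightarrowtail> El (cU 0) \<rightarrowtail> SET)"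
    by (rule ctt_abs[OF is_type_SET[OF context_wf(4)[OF P]] ab])
  have "eq_term \<Gamma> (Abs (Abs (rel (V 1) (dec (V 0)))) \<cdot> P) (Abs (rel (lift_tm P) (dec (V 0)))) (El (cU 0) \<rightarrowtail> SET)"
    using ctt_eq_beta[OF ab P] by (simp add: numeral_eq_Suc)
  from ctt_eq_app[OF this ctt_eq_refl[OF i]]
  have 1: "eq_term \<Gamma> (Abs (Abs (rel (V 1) (dec (V 0)))) \<cdot> P \<cdot> i) (Abs (rel (lift_tm P) (dec (V 0))) \<cdot> i) SET"
    by simp
  note ctx3 = ctx_El[OF U[OF context_wf(4)[OF P]]]
  have "has_type (El (cU 0) # \<Gamma>) (rel (lift_tm P) (dec (V 0))) SET"
    using has_type_V0[OF ctx3] by (intro rel_SET dec_SET weaken_SET[OF P ctx3]) simp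
  from ctt_eq_beta[OF this i]
  have "eq_term \<Gamma> (Abs (rel (lift_tm P) (dec (V 0))) \<cdot> i) (rel P (dec i)) SET" by simp
  with 1 show "eq_term \<Gamma> (Abs (Abs (rel (V 1) (dec (V 0)))) \<cdot> P \<cdot> i) (rel P (dec i)) SET"
    by (rule ctt_eq_trans)
qed

lemma GUP_DML_contradiction:
  assumes D: "has_type \<Gamma> D DML_CTT" and g: "has_type \<Gamma> g GUP_elem_ty"
    and g': "has_type \<Gamma> g' (inst_ty GUP_proof_ty g)"
  shows "inh \<Gamma> Falsum"
proof -
  note ctx = context_wf(4)[OF D] 
  note ctx' = ctx_SET[OF ctx]
  let ?I = "C (cU 0)" and ?R = "Abs (Abs (rel (V 1) (dec (V 0))))"
  let ?b = "sel (neg (neg (V 0))) (neg (V 0)) (lift_tm D \<cdot> V 0)"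
  let ?F = "Abs ?b"
  have I: "has_type \<Delta> ?I SET" if "is_ctx \<Delta>" for \<Delta> using that by (simp add: has_type_const)
  have V0: "has_type (SET # \<Gamma>) (V 0) SET" using has_type_V0[OF ctx'] by simp
  have "has_type (SET # \<Gamma>) (lift_tm D) (ren_ty Suc DML_CTT)" by (rule weaken_has_type[OF D ctx'])
  then have q: "has_type (SET # \<Gamma>) (lift_tm D \<cdot> V 0) (El (cPlus \<cdot> neg (neg (V 0)) \<cdot> neg (V 0)))"
    using has_type_app[OF _ V0] by (simp add: DML_CTT_def Or_tm_def Not_tm_eq)
  have b: "has_type (SET # \<Gamma>) ?b (El ?I)"
    by (intro sel_type neg_SET V0 q)
  have F: "has_type \<Gamma> ?F (SET \<rightarrowtail> El (lift_tm ?I))"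
    using ctt_abs[OF is_type_SET[OF ctx] b] by simp
  \<comment> \<open>The typing of the family is bundled with its beta rule, so well-typed closed
    instances of \<open>P\<close> and \<open>i\<close> are supplied.\<close>
  have R: "has_type \<Gamma> ?R (SET \<rightarrowtail> El (lift_tm ?I) \<rightarrowtail> SET)"
    using rel_fam_beta(2)[of \<Gamma> Falsum "C (cuN0 0)"] by (simp add: has_type_const ctx)
  have "has_type (SET # \<Gamma>) (lift_tm ?F) (SET \<rightarrowtail> El ?I)" using weaken_has_type[OF F ctx'] by simp
  then have F0: "has_type (SET # \<Gamma>) (lift_tm ?F \<cdot> V 0) (El ?I)"
    by (rule has_type_app[OF _ V0]) simp
  \<comment> \<open>Lifting \<open>?F\<close> and applying it to \<open>V 0\<close> beta-reduces to
    its own body.\<close>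
  have "eq_term (SET # \<Gamma>) (lift_tm ?F \<cdot> V 0) ?b (El ?I)"
    using ctt_eq_beta[OF weaken_under[OF b ctx'], of "V 0"] V0 is_type_SET[OF ctx'] by simp
  from rel_cong[OF dec_cong[OF this] dec_SET[OF F0] dec_SET[OF b] V0]
  have "eq_term (SET # \<Gamma>) (rel (V 0) (dec (lift_tm ?F \<cdot> V 0))) (rel (V 0) (dec ?b)) SET" .
  with rel_fam_beta(1)[OF V0 F0]
  have "eq_term (SET # \<Gamma>) (?R \<cdot> V 0 \<cdot> (lift_tm ?F \<cdot> V 0)) (rel (V 0) (dec ?b)) SET"
    by (rule ctt_eq_trans)
  moreover obtain h where "has_type (SET # \<Gamma>) h (El (rel (V 0) (dec ?b)))"
    using inh_rel_sel[OF V0 q] unfolding inh_def by blast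
  ultimately have "has_type (SET # \<Gamma>) h (El (?R \<cdot> V 0 \<cdot> (lift_tm ?F \<cdot> V 0)))"
    by (blast intro: ctt)
  then have h: "has_type \<Gamma> (Abs h) (SET \<rightarrowtail> El (lift_tm ?R \<cdot> V 0 \<cdot> (lift_tm ?F \<cdot> V 0)))"
    using ctt_abs[OF is_type_SET[OF ctx]] by simp
  let ?i = "g \<cdot> ?I \<cdot> ?R \<cdot> ?F \<cdot> Abs h"
  have i: "has_type \<Gamma> ?i (El ?I)" by (rule GUP_apply[OF g I[OF ctx] R F h])
  have rel: "inh \<Gamma> (rel P (dec ?i))" if P: "has_type \<Gamma> P SET" for P
    unfolding inh_def
    using GUP_proof_apply[OF g' I[OF ctx] R F h P] rel_fam_beta(1)[OF P i] rel_SET[OF P dec_SET[OF i]]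
    by (blast intro: ctt)
  have "inh \<Gamma> (neg (neg (dec ?i)))"
    using inh_rel_true_D[OF rel inh_N1[OF ctx] dec_SET[OF i]] inh_SET[OF inh_N1[OF ctx]] by blast
  moreover have "inh \<Gamma> (neg (dec ?i))"
    using inh_rel_false_D[OF rel inh_not_Falsum[OF ctx] _ dec_SET[OF i]] Falsum_SET[OF ctx] by blast
  ultimately show ?thesis by (rule inh_negE)
qed

section \<open>Well-formedness of the context formed by the principle and the law\<close>

lemma GUP_args_type:
  assumes "is_ctx \<Gamma>"
  defines "\<Delta> \<equiv> (SET \<rightarrowtail> El (V 2)) # (SET \<rightarrowtail> El (V 1) \<rightarrowtail> SET) # SET # \<Gamma>"
  shows "is_type \<Gamma> SET" "is_type (SET # \<Gamma>) (SET \<rightarrowtail> El (V 1) \<rightarrowtail> SET)"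
    "is_type ((SET \<rightarrowtail> El (V 1) \<rightarrowtail> SET) # SET # \<Gamma>) (SET \<rightarrowtail> El (V 2))"
    "is_type \<Delta> (SET \<rightarrowtail> El (V 2 \<cdot> V 0 \<cdot> (V 1 \<cdot> V 0)))"
proof -
  note ctx1 = ctx_SET[OF assms(1)]
  note ctx2 = ctx_SET[OF ctx1]
  have "has_type (SET # SET # \<Gamma>) (V 1) SET" by (rule has_type_var[OF ctx2]) simp_all
  then show R: "is_type (SET # \<Gamma>) (SET \<rightarrowtail> El (V 1) \<rightarrowtail> SET)"
    by (auto intro!: type_Fun is_type_SET ctx1 type_El ctx_El)
  note ctx3 = ctx_Cons[OF ctx1 R]
  have "has_type (SET # (SET \<rightarrowtail> El (V 1) \<rightarrowtail> SET) # SET # \<Gamma>) (V 2) SET"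
    by (rule has_type_var[OF ctx_SET[OF ctx3]]) simp_all
  then show F: "is_type ((SET \<rightarrowtail> El (V 1) \<rightarrowtail> SET) # SET # \<Gamma>) (SET \<rightarrowtail> El (V 2))"
    by (intro type_Fun is_type_SET ctx3 type_El)
  have ctx4: "is_ctx \<Delta>" unfolding \<Delta>_def by (rule ctx_Cons[OF ctx3 F])
  note ctx5 = ctx_SET[OF ctx4]
  have P: "has_type (SET # \<Delta>) (V 0) SET" by (rule has_type_var[OF ctx5]) simp_all
  have "has_type (SET # \<Delta>) (V 2) (SET \<rightarrowtail> El (V 4) \<rightarrowtail> SET)"
    by (rule has_type_var[OF ctx5]) (simp_all add: \<Delta>_def numeral_eq_Suc)
  from has_type_app[OF this P]
  have 1: "has_type (SET # \<Delta>) (V 2 \<cdot> V 0) (El (V 3) \<rightarrowtail> SET)" by (simp add: numeral_eq_Suc)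
  have "has_type (SET # \<Delta>) (V 1) (SET \<rightarrowtail> El (V 4))"
    by (rule has_type_var[OF ctx5]) (simp_all add: \<Delta>_def numeral_eq_Suc)
  from has_type_app[OF this P]
  have "has_type (SET # \<Delta>) (V 1 \<cdot> V 0) (El (V 3))" by (simp add: numeral_eq_Suc)
  from has_type_app[OF 1 this]
  have "has_type (SET # \<Delta>) (V 2 \<cdot> V 0 \<cdot> (V 1 \<cdot> V 0)) SET" by simp
  then show "is_type \<Delta> (SET \<rightarrowtail> El (V 2 \<cdot> V 0 \<cdot> (V 1 \<cdot> V 0)))"
    by (intro type_Fun is_type_SET ctx4 type_El)
qed (rule is_type_SET[OF assms(1)])

lemma GUP_elem_ty_type:
  assumes "is_ctx \<Gamma>" shows "is_type \<Gamma> GUP_elem_ty"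
proof -
  note T = GUP_args_type[OF assms]
  let ?\<Delta> = "(SET \<rightarrowtail> El (V 2 \<cdot> V 0 \<cdot> (V 1 \<cdot> V 0))) # (SET \<rightarrowtail> El (V 2)) # (SET \<rightarrowtail> El (V 1) \<rightarrowtail> SET) # SET # \<Gamma>"
  have "is_ctx ?\<Delta>" using T context_wf(2) by (blast intro: ctt)
  then have "has_type ?\<Delta> (V 3) SET" by (rule has_type_var) simp_all
  then show ?thesis unfolding GUP_elem_ty_def by (intro type_Fun T type_El)
qed

lemma GUP_proof_ty_type:
  assumes "is_ctx (GUP_elem_ty # \<Gamma>)" shows "is_type (GUP_elem_ty # \<Gamma>) GUP_proof_ty"
proof -
  note T = GUP_args_type[OF assms]
  let ?h = "SET \<rightarrowtail> El (V 2 \<cdot> V 0 \<cdot> (V 1 \<cdot> V 0))" and ?F = "SET \<rightarrowtail> El (V 2)" and ?R = "SET \<rightarrowtail> El (V 1) \<rightarrowtail> SET"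
  let ?\<Delta> = "SET # ?h # ?F # ?R # SET # GUP_elem_ty # \<Gamma>"
  have ctx4: "is_ctx (?h # ?F # ?R # SET # GUP_elem_ty # \<Gamma>)" using T context_wf(2) by (blast intro: ctt)
  note ctx = ctx_SET[OF ctx4]
  have g: "has_type ?\<Delta> (V 5) GUP_elem_ty"
    by (rule has_type_var[OF ctx]) (simp_all add: GUP_elem_ty_def numeral_eq_Suc)
  have I: "has_type ?\<Delta> (V 4) SET" by (rule has_type_var[OF ctx]) simp_all
  have R: "has_type ?\<Delta> (V 3) (SET \<rightarrowtail> El (lift_tm (V 4)) \<rightarrowtail> SET)"
    by (rule has_type_var[OF ctx]) (simp_all add: numeral_eq_Suc)
  have F: "has_type ?\<Delta> (V 2) (SET \<rightarrowtail> El (lift_tm (V 4)))"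
    by (rule has_type_var[OF ctx]) (simp_all add: numeral_eq_Suc)
  have h: "has_type ?\<Delta> (V 1) (SET \<rightarrowtail> El (lift_tm (V 3) \<cdot> V 0 \<cdot> (lift_tm (V 2) \<cdot> V 0)))"
    by (rule has_type_var[OF ctx]) (simp_all add: numeral_eq_Suc)
  have P: "has_type ?\<Delta> (V 0) SET" by (rule has_type_var[OF ctx]) simp_all
  have i: "has_type ?\<Delta> (V 5 \<cdot> V 4 \<cdot> V 3 \<cdot> V 2 \<cdot> V 1) (El (V 4))"
    by (rule GUP_apply[OF g I R F h])
  have RP: "has_type ?\<Delta> (V 3 \<cdot> V 0) (El (V 4) \<rightarrowtail> SET)"
    by (rule has_type_app[OF R P]) simp
  have "has_type ?\<Delta> (V 3 \<cdot> V 0 \<cdot> (V 5 \<cdot> V 4 \<cdot> V 3 \<cdot> V 2 \<cdot> V 1)) SET"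
    by (rule has_type_app[OF RP i]) simp
  then show ?thesis unfolding GUP_proof_ty_def
    by (intro type_Fun T is_type_SET ctx4 type_El)
qed

text \<open>The \<open>var\<close> rule demands a well-formed context, so this precedes any use of
  the assumptions.\<close>

lemma DML_GUP_ctx: "is_ctx (DML_CTT # GUP_CTT)"
proof -
  have 1: "is_ctx GUP_CTT" unfolding GUP_CTT_def
    by (intro ctx_Cons GUP_proof_ty_type GUP_elem_ty_type ctx_Nil)
  note ctx = ctx_SET[OF 1]
  have "has_type (SET # GUP_CTT) (V 0) SET" using has_type_V0[OF ctx] by simp
  then have "has_type (SET # GUP_CTT) (Or_tm (Not_tm (Not_tm (V 0))) (Not_tm (V 0))) SET"
    unfolding Or_tm_def Not_tm_eq by (intro Plus_SET neg_SET)
  then show ?thesis unfolding DML_CTT_def by (intro ctx_Cons type_Fun 1 is_type_SET type_El)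
qed

lemma GUP_CTT_DML_inconsistent: "\<exists>a. has_type (DML_CTT # GUP_CTT) a (El Falsum)"
proof -
  let ?\<Gamma> = "DML_CTT # GUP_CTT"
  \<comment> \<open>Variables 0, 1, 2 are the law, \<open>gup_1\<close> and \<open>gup_0\<close>;
    the type of variable 1 therefore mentions \<open>V 2\<close>.\<close>
  have "has_type ?\<Gamma> (V 0) DML_CTT"
    by (rule has_type_var[OF DML_GUP_ctx]) (simp_all add: DML_CTT_def Or_tm_def Not_tm_def)
  moreover have "has_type ?\<Gamma> (V 2) GUP_elem_ty"
    by (rule has_type_var[OF DML_GUP_ctx]) (simp_all add: GUP_CTT_def GUP_elem_ty_def numeral_eq_Suc)
  moreover have "has_type ?\<Gamma> (V 1) (inst_ty GUP_proof_ty (V 2))"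
    by (rule has_type_var[OF DML_GUP_ctx]) (simp_all add: GUP_CTT_def GUP_proof_ty_def numeral_eq_Suc)
  ultimately show ?thesis using GUP_DML_contradiction unfolding inh_def by blast
qed

section \<open>Set theory\<close>

lemma derivable_mono: "derivable T \<Gamma> A \<Longrightarrow> \<Gamma> \<subseteq> \<Delta> \<Longrightarrow> derivable T \<Delta> A"
proof (induction arbitrary: \<Delta> rule: derivable.induct)
  case (OrE \<Gamma> A B C)
  then show ?case by (meson derivable.OrE insert_mono)
next
  case (ImpI A \<Gamma> B)
  then show ?case by (meson derivable.ImpI insert_mono)
next
  case (ImpE \<Gamma> A B)
  then show ?case by (meson derivable.ImpE)
next
  case (AllI \<Gamma> A)
  then show ?case by (meson derivable.AllI image_mono)
next
  case (ExE \<Gamma> A C)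
  then show ?case by (meson derivable.ExE image_mono insert_mono)
next
  case (EqE \<Gamma> j k A)
  then show ?case by (meson derivable.EqE)
qed (auto intro: derivable.intros)

lemma derivable_cut: "derivable T \<Gamma> A \<Longrightarrow> derivable T (insert A \<Gamma>) B \<Longrightarrow> derivable T \<Gamma> B"
  by (blast intro: derivable.ImpI derivable.ImpE)

lemma derivable_AllE: "derivable T \<Gamma> (All A) \<Longrightarrow> plug 0 [k] A = B \<Longrightarrow> derivable T \<Gamma> B"
  by (blast intro: derivable.AllE)

lemma derivable_ExI: "derivable T \<Gamma> B \<Longrightarrow> plug 0 [k] A = B \<Longrightarrow> derivable T \<Gamma> (Ex A)"
  by (blast intro: derivable.ExI)

lemma derivable_iffD1: "derivable T \<Gamma> (Iff A B) \<Longrightarrow> derivable T \<Gamma> A \<Longrightarrow> derivable T \<Gamma> B"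
  by (blast intro: derivable.ImpE derivable.AndE1)

lemma derivable_iffD2: "derivable T \<Gamma> (Iff A B) \<Longrightarrow> derivable T \<Gamma> B \<Longrightarrow> derivable T \<Gamma> A"
  by (blast intro: derivable.ImpE derivable.AndE2)

lemma lift_DML: "lift_fm (DML_CZF t) = DML_CZF (Suc t)"
  by (simp add: DML_CZF_def subset_cl_def eq_cl_def un_cl_def star_cl_def set_cl_def sing_cl_def)

text \<open>Weak excluded middle for the propositions \<open>t \<in> x\<close>, with
  \<open>x\<close> unbounded as in the uniformity principle.\<close>

definition WEM :: "nat \<Rightarrow> fm" where
  "WEM t = All (Or (Neg (Mem (Suc t) 0)) (Neg (Neg (Mem (Suc t) 0))))"

lemma CZF_separation:
  assumes "CZF \<subseteq> T" "bounded_fm A"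
  shows "derivable T \<Gamma> (plug 0 [x] (Ex (All (Iff (Mem 0 1) (And (Mem 0 2) (plug 3 [0, 2] A))))))"
  using derivable.AllE[OF derivable.ax] CZF.Bounded_Separation[OF assms(2)] assms(1) by blast

lemma CZF_pair:
  assumes "CZF \<subseteq> T"
  shows "derivable T \<Gamma> (Ex (All (Iff (Mem 0 1) (Or (Eq 0 (Suc (Suc a))) (Eq 0 (Suc (Suc b)))))))"
proof -
  have "derivable T \<Gamma> (All (All (Ex (All (Iff (Mem 0 1) (Or (Eq 0 3) (Eq 0 2)))))))"
    by (rule derivable.ax) (use CZF.Pairing assms in blast)
  from derivable_AllE[OF derivable_AllE[OF this, of a, OF refl, unfolded plug_def, simplified], of b, OF refl]
  show ?thesis by (simp add: plug_def numeral_eq_Suc)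
qed

text \<open>For a set \<open>x\<close>, the law is applied to \<open>S = {y \<in> x. y = t}\<close>.
  This is a subset of \<open>{t}\<close>, and \<open>t \<in> S\<close> is equivalent to
  \<open>t \<in> x\<close>.\<close>

lemma DML_imp_WEM:
  assumes "CZF \<subseteq> T"
  shows "derivable T {DML_CZF t} (WEM t)"
  unfolding WEM_def
proof (rule derivable.AllI)
  \<comment> \<open>\<open>?S\<close> defines the separated set. In \<open>?\<Delta>\<close>,
    variable 0 is \<open>S\<close>, variable 1 is \<open>x\<close>, and \<open>t\<close> has moved
    up by two.\<close>
  let ?S = "All (Iff (Mem 0 1) (And (Mem 0 2) (Eq 0 (Suc (Suc (Suc t))))))"
  let ?\<Delta> = "insert ?S {DML_CZF (Suc (Suc t))}"
  let ?t = "Suc (Suc t)"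
  have S: "derivable T ?\<Delta> (Iff (Mem k 0) (And (Mem k 1) (Eq k ?t)))" for k
    by (rule derivable_AllE[where k = k, OF derivable.hyp[of ?S]]) (simp_all add: plug_def numeral_eq_Suc)
  let ?in = "Mem ?t 0"
  have D: "derivable T ?\<Delta> (Imp (All (Imp (Mem 0 1) (Eq 0 (Suc ?t))))
     (All (Iff (Or (And (Eq 0 (Suc ?t)) (Neg (And (Eq 0 (Suc ?t)) (Neg (Mem 0 1)))))
                   (And (Eq 0 (Suc ?t)) (Neg (Mem 0 1)))) (Eq 0 (Suc ?t)))))"
    by (rule derivable_AllE[where k = 0, OF derivable.hyp[of "DML_CZF ?t", unfolded DML_CZF_def]])
      (simp_all add: DML_CZF_def plug_def numeral_eq_Suc subset_cl_def eq_cl_def un_cl_def star_cl_def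
        set_cl_def sing_cl_def)
  have "derivable T (lift_fm ` ?\<Delta>) (Imp (Mem 0 1) (Eq 0 (Suc ?t)))"
  proof (rule derivable.ImpI)
    let ?\<Theta> = "insert (Mem 0 1) (lift_fm ` ?\<Delta>)"
    have "derivable T ?\<Theta> (Iff (Mem 0 1) (And (Mem 0 2) (Eq 0 (Suc ?t))))"
      by (rule derivable_AllE[where k = 0, OF derivable.hyp[of "lift_fm ?S", unfolded ren_fm.simps]]) (simp_all add: plug_def numeral_eq_Suc)
    from derivable_iffD1[OF this derivable.hyp]
    show "derivable T ?\<Theta> (Eq 0 (Suc ?t))" by (auto intro: derivable.AndE2)
  qed
  then have "derivable T ?\<Delta> (All (Imp (Mem 0 1) (Eq 0 (Suc ?t))))" by (rule derivable.AllI)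
  \<comment> \<open>The equality of classes is read at the point \<open>t\<close>, where membership
    in \<open>{t}\<close> is reflexivity.\<close>
  from derivable_AllE[OF derivable.ImpE[OF D this], of ?t, OF refl]
  have "derivable T ?\<Delta> (Iff (Or (And (Eq ?t ?t) (Neg (And (Eq ?t ?t) (Neg ?in))))
                   (And (Eq ?t ?t) (Neg ?in))) (Eq ?t ?t))"
    by (simp add: plug_def numeral_eq_Suc)
  from derivable_iffD2[OF this derivable.EqI]
  have "derivable T ?\<Delta> (Or (And (Eq ?t ?t) (Neg (And (Eq ?t ?t) (Neg ?in)))) (And (Eq ?t ?t) (Neg ?in)))" .
  then have "derivable T ?\<Delta> (Or (Neg (Mem ?t 1)) (Neg (Neg (Mem ?t 1))))"
  proof (rule derivable.OrE)
    let ?H = "And (Eq ?t ?t) (Neg (And (Eq ?t ?t) (Neg ?in)))"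
    let ?\<Theta> = "insert ?in (insert (Neg (Mem ?t 1)) (insert ?H ?\<Delta>))"
    have "derivable T ?\<Theta> (And (Mem ?t 1) (Eq ?t ?t))"
      by (rule derivable_iffD1[OF derivable_mono[OF S[of ?t]] derivable.hyp]) auto
    \<comment> \<open>If \<open>t\<close> is not in \<open>x\<close> it is not in \<open>S\<close>
      either, which membership of \<open>t\<close> in the double star of \<open>S\<close>
      excludes.\<close>
    then have "derivable T ?\<Theta> Bot"
      by (blast intro: derivable.AndE1 derivable.ImpE derivable.hyp)
    then have "derivable T (insert (Neg (Mem ?t 1)) (insert ?H ?\<Delta>)) (And (Eq ?t ?t) (Neg ?in))"
      by (intro derivable.AndI derivable.EqI derivable.ImpI)
    then have "derivable T (insert (Neg (Mem ?t 1)) (insert ?H ?\<Delta>)) Bot"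
      by (rule derivable.ImpE[OF derivable.AndE2[OF derivable.hyp[of ?H]], rotated]) simp
    then show "derivable T (insert ?H ?\<Delta>) (Or (Neg (Mem ?t 1)) (Neg (Neg (Mem ?t 1))))"
      by (intro derivable.OrI2 derivable.ImpI)
  next
    let ?H = "And (Eq ?t ?t) (Neg ?in)"
    let ?\<Theta> = "insert (Mem ?t 1) (insert ?H ?\<Delta>)"
    have "derivable T ?\<Theta> ?in"
      by (rule derivable_iffD2[OF derivable_mono[OF S[of ?t]] derivable.AndI[OF derivable.hyp derivable.EqI]]) auto
    then have "derivable T ?\<Theta> Bot"
      by (rule derivable.ImpE[OF derivable.AndE2[OF derivable.hyp[of ?H]], rotated]) simp
    then show "derivable T (insert ?H ?\<Delta>) (Or (Neg (Mem ?t 1)) (Neg (Neg (Mem ?t 1))))"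
      by (intro derivable.OrI1 derivable.ImpI)
  qed
  then have "derivable T (insert ?S (lift_fm ` lift_fm ` {DML_CZF t}))
      (lift_fm (Or (Neg (Mem (Suc t) 0)) (Neg (Neg (Mem (Suc t) 0)))))"
    by (simp add: lift_DML)
  \<comment> \<open>In the schema formula, indices 0 and 1 are its own arguments, so the parameter
    \<open>Suc t\<close> of the present context appears there two higher.\<close>
  moreover have "derivable T (lift_fm ` {DML_CZF t}) (Ex ?S)"
    using CZF_separation[OF assms, of "Eq 0 (Suc (Suc (Suc t)))" _ 0]
    by (simp add: plug_def numeral_eq_Suc bounded_fm.intros)
  ultimately show "derivable T (lift_fm ` {DML_CZF t}) (Or (Neg (Mem (Suc t) 0)) (Neg (Neg (Mem (Suc t) 0))))"
    by (rule derivable.ExE[rotated])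
qed

text \<open>Here \<open>e\<close> and \<open>s\<close> play false and true: only
  \<open>t \<notin> e\<close> and \<open>t \<in> s\<close> matter. The relation between
  \<open>x\<close> and \<open>y\<close> is that \<open>t \<notin> x\<close> and
  \<open>t \<notin> y\<close> are equivalent.\<close>

lemma GUP_WEM_contradiction:
  assumes "GUP_CZF \<subseteq> T"
  shows "derivable T {Mem e I, Mem s I, Mem t s, Neg (Mem t e), WEM t} Bot"
proof -
  let ?\<Gamma> = "{Mem e I, Mem s I, Mem t s, Neg (Mem t e), WEM t}"
  let ?\<Delta> = "{Mem (Suc e) (Suc I), Mem (Suc s) (Suc I), Mem (Suc t) (Suc s),
    Neg (Mem (Suc t) (Suc e)), WEM (Suc t)}"
  have lift: "lift_fm ` ?\<Gamma> = ?\<Delta>" by (simp add: WEM_def)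
  \<comment> \<open>Index 0 is \<open>x\<close>, index 1 is \<open>y\<close>, and index 2 is
    reserved for \<open>I\<close>, so \<open>t\<close> is shifted by three. \<open>?B\<close> and
    \<open>?Y\<close> are the matrices of premise and conclusion once \<open>I\<close> is
    supplied.\<close>
  let ?A = "Iff (Neg (Mem (Suc (Suc (Suc t))) 0)) (Neg (Mem (Suc (Suc (Suc t))) 1))"
  let ?B = "And (Mem 0 (Suc (Suc I))) (Iff (Neg (Mem (Suc (Suc t)) 1)) (Neg (Mem (Suc (Suc t)) 0)))"
  let ?Y = "And (Mem 0 (Suc I)) (All (Iff (Neg (Mem (Suc (Suc t)) 0)) (Neg (Mem (Suc (Suc t)) 1))))"
  have "derivable T ?\<Gamma> (All (Imp (All (Bex_fm 1 (plug 3 [1, 0, 2] ?A))) (Bex_fm 0 (All (plug 3 [0, 1, 2] ?A)))))"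
    by (rule derivable.ax) (use assms in \<open>auto simp: GUP_CZF_def\<close>)
  from derivable_AllE[OF this, of I, OF refl]
  have G: "derivable T ?\<Gamma> (Imp (All (Ex ?B)) (Ex ?Y))"
    by (simp add: plug_def numeral_eq_Suc)
  have "derivable T ?\<Delta> (Or (Neg (Mem (Suc t) 0)) (Neg (Neg (Mem (Suc t) 0))))"
    by (rule derivable_AllE[where k = 0, OF derivable.hyp[of "WEM (Suc t)", unfolded WEM_def]])
      (simp_all add: WEM_def plug_def)
  then have "derivable T ?\<Delta> (Ex ?B)"
  proof (rule derivable.OrE)
    \<comment> \<open>Witness \<open>e\<close>: both sides of the equivalence are
      assumptions.\<close>
    show "derivable T (insert (Neg (Mem (Suc t) 0)) ?\<Delta>) (Ex ?B)"
      by (rule derivable_ExI[of _ _ "And (Mem (Suc e) (Suc I)) (Iff (Neg (Mem (Suc t) 0)) (Neg (Mem (Suc t) (Suc e))))" "Suc e"])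
        (rule derivable.AndI[OF derivable.hyp derivable.AndI[OF derivable.ImpI[OF derivable.hyp] derivable.ImpI[OF derivable.hyp]]],
          simp_all add: plug_def)
    \<comment> \<open>Witness \<open>s\<close>: both sides of the equivalence are refutable.\<close>
    let ?\<Theta> = "insert (Neg (Neg (Mem (Suc t) 0))) ?\<Delta>"
    have "derivable T (insert (Neg (Mem (Suc t) 0)) ?\<Theta>) Bot"
      by (rule derivable.ImpE[OF derivable.hyp derivable.hyp, of "Neg (Mem (Suc t) 0)"]) auto
    moreover have "derivable T (insert (Neg (Mem (Suc t) (Suc s))) ?\<Theta>) Bot"
      by (rule derivable.ImpE[OF derivable.hyp derivable.hyp, of "Mem (Suc t) (Suc s)"]) auto
    ultimately have "derivable T ?\<Theta> (And (Mem (Suc s) (Suc I)) (Iff (Neg (Mem (Suc t) 0)) (Neg (Mem (Suc t) (Suc s)))))"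
      by (intro derivable.AndI derivable.ImpI[OF derivable.BotE]) (simp_all add: derivable.hyp)
    then show "derivable T ?\<Theta> (Ex ?B)"
      by (rule derivable_ExI[of _ _ _ "Suc s"]) (simp add: plug_def)
  qed
  then have "derivable T ?\<Gamma> (All (Ex ?B))" unfolding lift[symmetric] by (rule derivable.AllI)
  then have "derivable T ?\<Gamma> (Ex ?Y)" by (rule derivable.ImpE[OF G])
  moreover have "derivable T (insert ?Y (lift_fm ` ?\<Gamma>)) (lift_fm Bot)"
  proof -
    \<comment> \<open>Variable 0 is the uniform value. Taking \<open>k\<close> to be
      \<open>e\<close> shows that \<open>t\<close> is not in it, and then taking \<open>k\<close> to
      be \<open>s\<close> gives \<open>t \<notin> s\<close>.\<close>
    have Y: "derivable T (insert ?Y ?\<Delta>) (Iff (Neg (Mem (Suc t) k)) (Neg (Mem (Suc t) 0)))" for k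
      by (rule derivable_AllE[where k = k, OF derivable.AndE2[OF derivable.hyp[OF insertI1]]])
        (simp add: plug_def numeral_eq_Suc)
    have "derivable T (insert ?Y ?\<Delta>) (Neg (Mem (Suc t) 0))"
      by (rule derivable_iffD1[OF Y derivable.hyp]) auto
    from derivable_iffD2[OF Y this]
    have "derivable T (insert ?Y ?\<Delta>) (Neg (Mem (Suc t) (Suc s)))" .
    then have "derivable T (insert ?Y ?\<Delta>) Bot" by (rule derivable.ImpE) (rule derivable.hyp, simp)
    then show ?thesis by (simp only: lift ren_fm.simps)
  qed
  ultimately show ?thesis
    by (rule derivable.ExE)
qed

text \<open>The law is an open assumption rather than an axiom, so \<open>t\<close> stays fixed and
  the law is used for this one set \<open>\<top>\<close> only.\<close>

lemma GUP_CZF_DML_inconsistent: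
  assumes "CZF \<subseteq> T" "GUP_CZF \<subseteq> T"
  shows "derivable T {DML_CZF t} Bot"
proof -
  \<comment> \<open>\<open>?E e t\<close> makes \<open>e\<close> the empty set, separated from
    \<open>t\<close> by falsity; \<open>?P p a b\<close> makes \<open>p\<close> the pair of
    \<open>a\<close> and \<open>b\<close>. These are the forms that Separation and Pairing
    deliver.\<close>
  let ?E = "\<lambda>e t. All (Iff (Mem 0 (Suc e)) (And (Mem 0 (Suc t)) Bot))"
  let ?P = "\<lambda>p a b. All (Iff (Mem 0 (Suc p)) (Or (Eq 0 (Suc a)) (Eq 0 (Suc b))))"
  let ?t1 = "Suc t" and ?t2 = "Suc (Suc t)" and ?t3 = "Suc (Suc (Suc t))"
  \<comment> \<open>Variable 2 is the empty set, variable 1 is \<open>{t}\<close>, variable 0 is the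
    index set \<open>I\<close> formed from these two, and \<open>t\<close> has moved up by
    three.\<close>
  let ?\<Gamma> = "{?P 0 2 1, ?P 1 ?t3 ?t3, ?E 2 ?t3, DML_CZF ?t3}"
  have E: "derivable T ?\<Gamma> (Iff (Mem ?t3 2) (And (Mem ?t3 ?t3) Bot))"
    by (rule derivable_AllE[where k = ?t3, OF derivable.hyp[of "?E 2 ?t3"]]) (simp_all add: plug_def numeral_eq_Suc)
  have S: "derivable T ?\<Gamma> (Iff (Mem ?t3 1) (Or (Eq ?t3 ?t3) (Eq ?t3 ?t3)))"
    by (rule derivable_AllE[where k = ?t3, OF derivable.hyp[of "?P 1 ?t3 ?t3"]]) (simp_all add: plug_def numeral_eq_Suc)
  have P: "derivable T ?\<Gamma> (Iff (Mem k 0) (Or (Eq k 2) (Eq k 1)))" for k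
    by (rule derivable_AllE[where k = k, OF derivable.hyp[of "?P 0 2 1"]]) (simp_all add: plug_def numeral_eq_Suc)
  have 1: "derivable T ?\<Gamma> (Mem 2 0)"
    by (rule derivable_iffD2[OF P derivable.OrI1[OF derivable.EqI]])
  have 2: "derivable T ?\<Gamma> (Mem 1 0)"
    by (rule derivable_iffD2[OF P derivable.OrI2[OF derivable.EqI]])
  have 3: "derivable T ?\<Gamma> (Mem ?t3 1)"
    by (rule derivable_iffD2[OF S derivable.OrI1[OF derivable.EqI]])
  have 4: "derivable T ?\<Gamma> (Neg (Mem ?t3 2))"
    by (rule derivable.ImpI, rule derivable.AndE2, rule derivable_iffD1[OF derivable_mono[OF E] derivable.hyp])
      auto
  have 5: "derivable T ?\<Gamma> (WEM ?t3)"
    by (rule derivable_mono[OF DML_imp_WEM[OF assms(1)]]) simp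
  \<comment> \<open>The five assumptions of the preceding lemma are cut in one after
    another.\<close>
  have bot: "derivable T ?\<Gamma> Bot"
    apply (rule derivable_cut[OF 1], rule derivable_cut[OF derivable_mono[OF 2]], blast)
    apply (rule derivable_cut[OF derivable_mono[OF 3]], blast, rule derivable_cut[OF derivable_mono[OF 4]], blast)
    apply (rule derivable_cut[OF derivable_mono[OF 5]], blast)
    by (rule derivable_mono[OF GUP_WEM_contradiction[OF assms(2), of 2 0 1 ?t3]]) blast
  \<comment> \<open>The three existence statements are discharged from the inside out:
    \<open>I\<close>, then \<open>{t}\<close>, then the empty set, each lowering the indices by
    one.\<close>
  have "derivable T {?P 0 ?t2 ?t2, ?E 1 ?t2, DML_CZF ?t2} Bot"
    by (rule derivable.ExE[OF CZF_pair[OF assms(1), of _ 1 0]]) (use bot in \<open>simp add: lift_DML numeral_eq_Suc\<close>)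
  then have "derivable T (insert (?P 0 ?t2 ?t2) (lift_fm ` {?E 0 ?t1, DML_CZF ?t1})) (lift_fm Bot)"
    by (simp add: lift_DML)
  moreover have "derivable T {?E 0 ?t1, DML_CZF ?t1} (Ex (?P 0 ?t2 ?t2))"
    using CZF_pair[OF assms(1), of _ ?t1 ?t1] by simp
  ultimately have "derivable T {?E 0 ?t1, DML_CZF ?t1} Bot"
    by (rule derivable.ExE[rotated])
  then have "derivable T (insert (?E 0 ?t1) (lift_fm ` {DML_CZF t})) (lift_fm Bot)"
    by (simp add: lift_DML)
  moreover have "derivable T {DML_CZF t} (Ex (?E 0 ?t1))"
    using CZF_separation[OF assms(1) bounded_fm.intros(3), of _ t] by (simp add: plug_def numeral_eq_Suc)
  ultimately show ?thesis by (rule derivable.ExE[rotated])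
qed

theorem mainTheorem1:
  shows "(\<forall>t. derivable (CZF \<union> GUP_CZF) {DML_CZF t} Bot) \<and>
         (\<exists>a. has_type (DML_CTT # GUP_CTT) a (El Falsum))"
  using GUP_CZF_DML_inconsistent GUP_CTT_DML_inconsistent by simp

end
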